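(* Let $H_0:\mathbb T^N\times[0,T]\times\mathbb R^N\to\mathbb R$ be continuous, convex in $p$, superlinear in $p$ uniformly for $(x,t)\in\mathbb T^N\times[0,T]$, and differentiable in $p$ on $\mathbb R^N$. Let $g_0:\mathbb T^N\to\mathbb R$ be continuous. Then any $g_0$-optimal curve $\zeta$ is an integral curve of $W_{g_0}$ (i.e. $\zeta$ is absolutely continuous and $\dot\zeta(t)=W_{g_0}(\zeta(t),t)$ for a.e. $t\in[0,T]$), with $$(\zeta(t),t)\in\mathcal A_{g_0}\quad\text{for a.e. }t\in[0,T].$$
   Context: $\mathbb T^N$ is the $N$-dimensional flat torus, $T>0$, $\Gamma=C([0,T];\mathbb T^N)$. Uniform superlinearity means $H_0(x,t,p)/|p|\to+\infty$ as $|p|\to+\infty$ uniformly in $(x,t)$. $L_0(x,t,q)=\sup_p(p\cdot q-H_0(x,t,p))$; $A_{L_0}(\zeta)=\int_0^TL_0(\zeta,t,\dot\zeta)\,dt$ for absolutely continuous $\zeta\in\Gamma$ and $+\infty$ otherwise. The Lax–Oleinik solution with final datum $g_0$ is $v(x,t)=\min\{g_0(\zeta(T))+\int_t^TL_0(\zeta,s,\dot\zeta)\,ds:\ \zeta:[t,T]\to\mathbb T^N\text{ absolutely continuous},\ \zeta(t)=x\}$ for $t<T$, $v(x,T)=g_0(x)$. A curve $\zeta_0\in\Gamma$ is $g_0$-optimal if it minimizes $g_0(\zeta(T))+A_{L_0}(\zeta)$ among $\zeta\in\Gamma$ with $\zeta(0)=\zeta_0(0)$. For $(x,t)\in\mathbb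 T^N\times(0,T)$, $D_{(q,1)}v(x,t)=\lim_{h\to0}\frac{v(x+hq,t+h)-v(x,t)}h$ when it exists; $\mathcal W_{g_0}(x,t)=\{q\in\mathbb R^N:D_{(q,1)}v(x,t)\text{ exists and equals }-L_0(x,t,q)\}$; $\mathcal A_{g_0}=\{(x,t)\in\mathbb T^N\times(0,T):\mathcal W_{g_0}(x,t)\neq\emptyset\}$. Under the stated assumptions $\mathcal W_{g_0}(x,t)$ has at most one element; $W_{g_0}(x,t)$ is this element for $(x,t)\in\mathcal A_{g_0}$, and $W_{g_0}$ also denotes an arbitrarily fixed Borel extension of this map to $\mathbb T^N\times[0,T]$. *)

theory Defs
  imports "HOL-Analysis.Analysis"
begin

section \<open>The flat torus\<close>

definition int_lattice :: "(real ^ 'n) set"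
  where "int_lattice = {k. \<forall>i. k $ i \<in> \<int>}"

lemma int_lattice_closed: "closed (int_lattice :: (real ^ 'n) set)"
proof -
  have "int_lattice = (\<Inter>i. (\<lambda>k :: real ^ 'n. k $ i) -` \<int>)"
    by (auto simp: int_lattice_def)
  moreover have "closed ((\<lambda>k :: real ^ 'n. k $ i) -` \<int>)" for i
    by (intro continuous_closed_vimage closed_Ints) (auto intro!: continuous_intros)
  ultimately show ?thesis by (metis (no_types, lifting) closed_INT)
qed

lemma int_lattice_zero: "0 \<in> int_lattice"
  and int_lattice_add: "k \<in> int_lattice \<Longrightarrow> l \<in> int_lattice \<Longrightarrow> k + l \<in> int_lattice"
  and int_lattice_uminus: "k \<in> int_lattice \<Longrightarrow> - k \<in> int_lattice"
  and int_lattice_diff: "k \<in> int_lattice \<Longrightarrow> l \<in> int_lattice \<Longrightarrow> k - l \<in> int_lattice"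
  by (auto simp: int_lattice_def)

quotient_type 'n torus = "real ^ 'n::finite" / "\<lambda>x y. x - y \<in> int_lattice"
proof (rule equivpI)
  show "reflp (\<lambda>x y :: real ^ 'n. x - y \<in> int_lattice)"
    by (rule reflpI) (simp add: int_lattice_zero)
  show "symp (\<lambda>x y :: real ^ 'n. x - y \<in> int_lattice)"
    by (rule sympI) (metis int_lattice_uminus minus_diff_eq)
  show "transp (\<lambda>x y :: real ^ 'n. x - y \<in> int_lattice)"
    by (rule transpI) (metis int_lattice_add diff_add_cancel add_diff_eq)
qed

lemma infdist_int_lattice_attained:
  obtains k where "k \<in> int_lattice" "infdist u int_lattice = norm (u - k)"
  using infdist_attains_inf[OF int_lattice_closed, of u] int_lattice_zero
  by (metis dist_norm empty_iff)

lemma infdist_int_lattice_le: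
  "k \<in> int_lattice \<Longrightarrow> infdist u int_lattice \<le> norm (u - k)"
  using infdist_le[of k int_lattice u] by (simp add: dist_norm)

lemma infdist_int_lattice_shift:
  assumes "u - w \<in> int_lattice"
  shows "infdist u int_lattice = infdist w int_lattice"
proof -
  have "infdist u int_lattice \<le> infdist w int_lattice" if "u - w \<in> int_lattice" for u w :: "real ^ 'n"
  proof -
    obtain k where k: "k \<in> int_lattice" "infdist w int_lattice = norm (w - k)"
      by (rule infdist_int_lattice_attained)
    have "infdist u int_lattice \<le> norm (u - (k + (u - w)))"
      by (intro infdist_int_lattice_le int_lattice_add k that)
    then show ?thesis using k by (simp add: algebra_simps)
  qed
  from this[of u w] this[of w u] assms show ?thesis
    by (metis antisym int_lattice_uminus minus_diff_eq)
qed

lemma infdist_int_lattice_uminus: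
  "infdist (- u) int_lattice = infdist (u :: real ^ 'n) int_lattice"
proof -
  have "infdist (- u) int_lattice \<le> infdist u int_lattice" for u :: "real ^ 'n"
  proof -
    obtain k where k: "k \<in> int_lattice" "infdist u int_lattice = norm (u - k)"
      by (rule infdist_int_lattice_attained)
    have "infdist (- u) int_lattice \<le> norm (- u - (- k))"
      by (intro infdist_int_lattice_le int_lattice_uminus k)
    also have "\<dots> = norm (u - k)" by (metis minus_diff_minus norm_minus_cancel)
    finally show ?thesis using k by simp
  qed
  from this[of u] this[of "- u"] show ?thesis by simp
qed

lemma infdist_int_lattice_add:
  "infdist (u + w) int_lattice \<le> infdist u int_lattice + infdist (w :: real ^ 'n) int_lattice"
proof -
  obtain k where k: "k \<in> int_lattice" "infdist u int_lattice = norm (u - k)"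
    by (rule infdist_int_lattice_attained)
  obtain l where l: "l \<in> int_lattice" "infdist w int_lattice = norm (w - l)"
    by (rule infdist_int_lattice_attained)
  have "infdist (u + w) int_lattice \<le> norm ((u + w) - (k + l))"
    by (intro infdist_int_lattice_le int_lattice_add k l)
  also have "\<dots> = norm ((u - k) + (w - l))" by (simp add: algebra_simps)
  also have "\<dots> \<le> norm (u - k) + norm (w - l)" by (rule norm_triangle_ineq)
  finally show ?thesis using k l by simp
qed

instantiation torus :: (finite) metric_space
begin

text \<open>The quotient metric: the Euclidean distance between the two fibres.\<close>

lift_definition dist_torus :: "'a torus \<Rightarrow> 'a torus \<Rightarrow> real"
  is "\<lambda>x y. infdist (x - y) int_lattice"
proof -
  fix x x' y y' :: "real ^ 'a"
  assume *: "x - x' \<in> int_lattice" "y - y' \<in> int_lattice"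
  have "(x - y) - (x' - y') = (x - x') - (y - y')" by simp
  then show "infdist (x - y) int_lattice = infdist (x' - y') int_lattice"
    using int_lattice_diff[OF *] by (intro infdist_int_lattice_shift) (simp only:)
qed

definition uniformity_torus :: "('a torus \<times> 'a torus) filter"
  where "uniformity_torus = (INF e\<in>{0<..}. principal {(x, y). dist x y < e})"

definition open_torus :: "'a torus set \<Rightarrow> bool"
  where "open_torus U \<longleftrightarrow> (\<forall>x\<in>U. eventually (\<lambda>(x', y). x' = x \<longrightarrow> y \<in> U) uniformity)"

instance
proof
  show "uniformity = (INF e\<in>{0<..}. principal {(x :: 'a torus, y). dist x y < e})"
    by (rule uniformity_torus_def)
  show "open U \<longleftrightarrow> (\<forall>x\<in>U. \<forall>\<^sub>F (x', y) in uniformity. x' = x \<longrightarrow> y \<in> U)" for U :: "'a torus set"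
    by (rule open_torus_def)
  show "dist x y = 0 \<longleftrightarrow> x = y" for x y :: "'a torus"
  proof (transfer)
    fix x y :: "real ^ 'a"
    show "infdist (x - y) int_lattice = 0 \<longleftrightarrow> x - y \<in> int_lattice"
      using in_closed_iff_infdist_zero[OF int_lattice_closed, of "x - y"] int_lattice_zero by blast
  qed
  show "dist x y \<le> dist x z + dist y z" for x y z :: "'a torus"
  proof (transfer)
    fix x y z :: "real ^ 'a"
    show "infdist (x - y) int_lattice \<le> infdist (x - z) int_lattice + infdist (y - z) int_lattice"
      using infdist_int_lattice_add[of "x - z" "z - y"] infdist_int_lattice_uminus[of "y - z"]
      by simp
  qed
qed

end

lift_definition translate :: "'n::finite torus \<Rightarrow> real ^ 'n \<Rightarrow> 'n torus"  (infixl "\<oplus>" 65)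
  is "\<lambda>x u. x + u"
  by simp


section \<open>Curves\<close>

definition absolutely_continuous_curve :: "real \<Rightarrow> real \<Rightarrow> (real \<Rightarrow> 'a::metric_space) \<Rightarrow> bool"
  where "absolutely_continuous_curve a b \<zeta> \<longleftrightarrow>
    (\<forall>\<epsilon>>0. \<exists>\<delta>>0. \<forall>D :: (real \<times> real) set.
      finite D \<and> (\<forall>(c, d)\<in>D. a \<le> c \<and> c \<le> d \<and> d \<le> b) \<and>
      disjoint_family_on (\<lambda>(c, d). {c<..<d}) D \<and> (\<Sum>(c, d)\<in>D. d - c) < \<delta> \<longrightarrow>
      (\<Sum>(c, d)\<in>D. dist (\<zeta> c) (\<zeta> d)) < \<epsilon>)"

text \<open>The tangent space of the torus at every point is \<open>real ^ 'n\<close>; \<open>q\<close> is the derivative of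
  \<open>\<zeta>\<close> at \<open>t\<close> if \<open>\<zeta> (t + h) = \<zeta> t + h q + o(h)\<close>.\<close>

definition has_velocity :: "(real \<Rightarrow> 'n::finite torus) \<Rightarrow> real ^ 'n \<Rightarrow> real \<Rightarrow> bool"
  where "has_velocity \<zeta> q t \<longleftrightarrow>
    ((\<lambda>h. dist (\<zeta> (t + h)) (\<zeta> t \<oplus> h *\<^sub>R q) / \<bar>h\<bar>) \<longlongrightarrow> 0) (at 0)"

definition velocity :: "(real \<Rightarrow> 'n::finite torus) \<Rightarrow> real \<Rightarrow> real ^ 'n"
  where "velocity \<zeta> t = (THE q. has_velocity \<zeta> q t)"


section \<open>Lagrangian, action and value function\<close>

text \<open>For \<open>t \<in> {0..T}\<close> the supremum is finite when \<open>H x t\<close> is continuous and superlinear.\<close>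

definition Lagrangian ::
    "('n::finite torus \<Rightarrow> real \<Rightarrow> real ^ 'n \<Rightarrow> real) \<Rightarrow> 'n torus \<Rightarrow> real \<Rightarrow> real ^ 'n \<Rightarrow> real"
  where "Lagrangian H x t q = (SUP p. p \<bullet> q - H x t p)"

text \<open>Along an absolutely continuous curve the integrand is measurable and, since
  \<open>L x t q \<ge> - H x t 0\<close>, bounded below; so its integral exists in \<open>(-\<infinity>, \<infinity>]\<close> and is \<open>\<infinity>\<close>
  precisely when the integrand is not integrable.\<close>

definition action ::
    "('n::finite torus \<Rightarrow> real \<Rightarrow> real ^ 'n \<Rightarrow> real) \<Rightarrow> real \<Rightarrow> real \<Rightarrow> (real \<Rightarrow> 'n torus) \<Rightarrow> ereal"
  where "action L a b \<zeta> =
    (if absolutely_continuous_curve a b \<zeta> \<and>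
        set_integrable lebesgue {a..b} (\<lambda>s. L (\<zeta> s) s (velocity \<zeta> s))
     then ereal (LINT s:{a..b}|lebesgue. L (\<zeta> s) s (velocity \<zeta> s))
     else \<infinity>)"

text \<open>The infimum is finite and, by Tonelli's theorem, a minimum; writing it as an infimum
  makes the definition total.\<close>

definition lax_oleinik ::
    "('n::finite torus \<Rightarrow> real \<Rightarrow> real ^ 'n \<Rightarrow> real) \<Rightarrow> real \<Rightarrow> ('n torus \<Rightarrow> real)
      \<Rightarrow> 'n torus \<Rightarrow> real \<Rightarrow> real"
  where "lax_oleinik H T g x t =
    (if t < T then
       real_of_ereal (INF \<zeta>\<in>{\<zeta>. absolutely_continuous_curve t T \<zeta> \<and> \<zeta> t = x}.
         ereal (g (\<zeta> T)) + action (Lagrangian H) t T \<zeta>)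
     else g x)"

definition optimal_curve ::
    "('n::finite torus \<Rightarrow> real \<Rightarrow> real ^ 'n \<Rightarrow> real) \<Rightarrow> real \<Rightarrow> ('n torus \<Rightarrow> real)
      \<Rightarrow> (real \<Rightarrow> 'n torus) \<Rightarrow> bool"
  where "optimal_curve H T g \<zeta>\<^sub>0 \<longleftrightarrow>
    continuous_on {0..T} \<zeta>\<^sub>0 \<and>
    (\<forall>\<zeta>. continuous_on {0..T} \<zeta> \<and> \<zeta> 0 = \<zeta>\<^sub>0 0 \<longrightarrow>
      ereal (g (\<zeta>\<^sub>0 T)) + action (Lagrangian H) 0 T \<zeta>\<^sub>0
        \<le> ereal (g (\<zeta> T)) + action (Lagrangian H) 0 T \<zeta>)"


section \<open>The vector field of optimal velocities\<close>

text \<open>\<open>has_dir_deriv v x t q d\<close>: the derivative of \<open>v\<close> at \<open>(x, t)\<close> in direction \<open>(q, 1)\<close>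
  exists and equals \<open>d\<close>.\<close>

definition has_dir_deriv ::
    "('n::finite torus \<Rightarrow> real \<Rightarrow> real) \<Rightarrow> 'n torus \<Rightarrow> real \<Rightarrow> real ^ 'n \<Rightarrow> real \<Rightarrow> bool"
  where "has_dir_deriv v x t q d \<longleftrightarrow>
    ((\<lambda>h. (v (x \<oplus> h *\<^sub>R q) (t + h) - v x t) / h) \<longlongrightarrow> d) (at 0)"

definition optimal_velocities ::
    "('n::finite torus \<Rightarrow> real \<Rightarrow> real ^ 'n \<Rightarrow> real) \<Rightarrow> real \<Rightarrow> ('n torus \<Rightarrow> real)
      \<Rightarrow> 'n torus \<Rightarrow> real \<Rightarrow> (real ^ 'n) set"
  where "optimal_velocities H T g x t =
    {q. has_dir_deriv (lax_oleinik H T g) x t q (- Lagrangian H x t q)}"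

definition optimal_set ::
    "('n::finite torus \<Rightarrow> real \<Rightarrow> real ^ 'n \<Rightarrow> real) \<Rightarrow> real \<Rightarrow> ('n torus \<Rightarrow> real)
      \<Rightarrow> ('n torus \<times> real) set"
  where "optimal_set H T g = {(x, t). 0 < t \<and> t < T \<and> optimal_velocities H T g x t \<noteq> {}}"

definition borel_extension ::
    "('n::finite torus \<Rightarrow> real \<Rightarrow> real ^ 'n \<Rightarrow> real) \<Rightarrow> real \<Rightarrow> ('n torus \<Rightarrow> real)
      \<Rightarrow> ('n torus \<times> real \<Rightarrow> real ^ 'n) \<Rightarrow> bool"
  where "borel_extension H T g W \<longleftrightarrow>
    W \<in> borel_measurable (restrict_space borel (UNIV \<times> {0..T})) \<and>
    (\<forall>(x, t)\<in>optimal_set H T g. W (x, t) = the_elem (optimal_velocities H T g x t))"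

definition integral_curve ::
    "real \<Rightarrow> ('n::finite torus \<times> real \<Rightarrow> real ^ 'n) \<Rightarrow> (real \<Rightarrow> 'n torus) \<Rightarrow> bool"
  where "integral_curve T W \<zeta> \<longleftrightarrow>
    absolutely_continuous_curve 0 T \<zeta> \<and>
    (AE t\<in>{0..T} in lebesgue. has_velocity \<zeta> (W (\<zeta> t, t)) t)"

end

theory Submission
  imports Defs
begin

text \<open>By dynamic programming the value function satisfies
  \<open>v y s \<le> (s' - s) (L x t q + \<epsilon>) + v (y + (s' - s) q') s'\<close> for all data \<open>(y, s, s', q')\<close> close to
  \<open>(x, t, t, q)\<close>: follow a segment first. Along an optimal curve \<open>\<zeta>\<close> the value is a constant minus
  the running action, so at almost every time \<open>\<zeta>\<close> has a velocity \<open>q\<close> and the value along \<open>\<zeta>\<close> has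
  derivative \<open>- L (\<zeta> t) t q\<close>. Short segments between the curve and its tangent line transfer this
  derivative to the direction \<open>(q, 1)\<close>. Two optimal velocities at one point coincide because
  differentiability of \<open>H\<close> makes \<open>L\<close> strictly convex. The almost everywhere statements from real
  analysis follow from Vitali's covering theorem.\<close>

section \<open>Differentiation of absolutely continuous functions\<close>

text \<open>The curve and its tangent line agree only up to o(h), while \<open>v\<close> comes with
  no Lipschitz bound that would turn this into an o(h) difference of values. The segment inequality
  replaces such a bound. It bounds \<open>v\<close> from above at the start of a segment and from
  below at its end, so the point of the line at time t + h serves once as a start and once as an
  end. A segment cannot pass from the line to the curve in zero time; aiming at time t + 2 h leaves
  a duration of |h|, over which a gap of size o(h) changes the velocity by o(1).

  The value is an infimum, so competitors are taken optimal up to a slack that is removed at the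
  end. The exceptional sets of times are not known in advance to be measurable; hence the covering
  arguments run with outer measure, expressed as a number \<sigma> below the measure of every
  measurable superset.\<close>

text \<open>One family of gaps has to serve every \<open>h\<close>: below, the identity yields
  lengths and \<open>f\<close> yields increments. The induction removes the rightmost interval,
  recurses to the left of it and adds the gap to its right, which may be degenerate.\<close>

lemma interval_gaps:
  fixes a b :: real
  assumes "finite F" "a \<le> b" "\<And>c d. (c, d) \<in> F \<Longrightarrow> a \<le> c \<and> c < d \<and> d \<le> b"
    and "disjoint_family_on (\<lambda>(c, d). {c<..<d}) F"
  obtains G where "finite G" "\<And>c d. (c, d) \<in> G \<Longrightarrow> a \<le> c \<and> c \<le> d \<and> d \<le> b" "F \<inter> G = {}"
    "disjoint_family_on (\<lambda>(c, d). {c<..<d}) (F \<union> G)"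
    "\<And>h :: real \<Rightarrow> real. (\<Sum>(c, d)\<in>F \<union> G. h d - h c) = h b - h a"
proof -
  have "\<exists>G. finite G \<and> (\<forall>(c, d)\<in>G. a \<le> c \<and> c \<le> d \<and> d \<le> b) \<and> F \<inter> G = {} \<and>
    disjoint_family_on (\<lambda>(c, d). {c<..<d}) (F \<union> G) \<and>
    (\<forall>h :: real \<Rightarrow> real. (\<Sum>(c, d)\<in>F \<union> G. h d - h c) = h b - h a)"
    using assms
  proof (induction "card F" arbitrary: F b)
    case 0
    then show ?case
      by (intro exI[of _ "{(a, b)}"]) (auto simp: disjoint_family_on_def)
  next
    case (Suc n)
    have "F \<noteq> {}" using Suc by auto
    have fin: "finite F" by fact
    have "Max (fst ` F) \<in> fst ` F" using fin \<open>F \<noteq> {}\<close> by simp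
    then obtain p where "p \<in> F" and eq: "fst p = Max (fst ` F)" by (metis imageE)
    then have p: "p \<in> F" "\<And>p'. p' \<in> F \<Longrightarrow> fst p' \<le> fst p"
      using fin by (simp_all add: eq)
    obtain c d where "p = (c, d)" by fastforce
    with p have cd: "(c, d) \<in> F" and cmax: "\<And>c' d'. (c', d') \<in> F \<Longrightarrow> c' \<le> c"
      by force+
    define F' where "F' = F - {(c, d)}"
    have cd': "a \<le> c" "c < d" "d \<le> b" using Suc.prems(3)[OF cd] by auto
    have F'c: "d' \<le> c" if "(c', d') \<in> F'" for c' d'
    proof (rule ccontr)
      assume "\<not> d' \<le> c"
      \<comment> \<open>An interval reaching beyond \<open>c\<close> starts at or before
        \<open>c\<close>, by maximality, and so shares this midpoint with the rightmost one.\<close>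
      then have "(c + min d d') / 2 \<in> {c<..<d} \<inter> {c'<..<d'}"
        using cmax[of c' d'] that cd' by (auto simp: F'_def min_def field_simps)
      moreover have "{c<..<d} \<inter> {c'<..<d'} = {}"
        using disjoint_family_onD[OF Suc.prems(4) cd, of "(c', d')"] that by (auto simp: F'_def)
      ultimately show False by blast
    qed
    have "\<exists>G. finite G \<and> (\<forall>(c', d)\<in>G. a \<le> c' \<and> c' \<le> d \<and> d \<le> c) \<and> F' \<inter> G = {} \<and>
      disjoint_family_on (\<lambda>(c, d). {c<..<d}) (F' \<union> G) \<and>
      (\<forall>h :: real \<Rightarrow> real. (\<Sum>(c, d)\<in>F' \<union> G. h d - h c) = h c - h a)"
    proof (rule Suc.hyps(1))
      show "n = card F'" using Suc.hyps(2) fin cd(1) by (simp add: F'_def)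
      show "finite F'" using fin by (simp add: F'_def)
      show "a \<le> c" by fact
      show "a \<le> c' \<and> c' < d' \<and> d' \<le> c" if "(c', d') \<in> F'" for c' d'
        using F'c[OF that] Suc.prems(3)[of c' d'] that by (auto simp: F'_def)
      show "disjoint_family_on (\<lambda>(c, d). {c<..<d}) F'"
        by (rule disjoint_family_on_mono[OF _ Suc.prems(4)]) (auto simp: F'_def)
    qed
    then obtain G where G: "finite G" "\<forall>(c', d)\<in>G. a \<le> c' \<and> c' \<le> d \<and> d \<le> c"
      "F' \<inter> G = {}" "disjoint_family_on (\<lambda>(c, d). {c<..<d}) (F' \<union> G)"
      and sumG: "\<forall>h :: real \<Rightarrow> real. (\<Sum>(c, d)\<in>F' \<union> G. h d - h c) = h c - h a"
      by (elim exE conjE)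
    have le_c: "d' \<le> c" if "(c', d') \<in> F' \<union> G" for c' d'
      using that F'c[of c' d'] bspec[OF G(2), of "(c', d')"] by auto
    have "F = insert (c, d) F'" using cd(1) by (auto simp: F'_def)
    then have eq: "F \<union> insert (d, b) G = insert (c, d) (insert (d, b) (F' \<union> G))"
      by auto
    have new: "(c, d) \<notin> insert (d, b) (F' \<union> G)" "(d, b) \<notin> F' \<union> G"
      using le_c[of c d] le_c[of d b] cd' by auto
    show ?case
    proof (intro exI[of _ "insert (d, b) G"] conjI allI)
      show "finite (insert (d, b) G)" using G by simp
      show "\<forall>(c, d)\<in>insert (d, b) G. a \<le> c \<and> c \<le> d \<and> d \<le> b" using G(2) cd' by auto
      show "F \<inter> insert (d, b) G = {}" using new G(3) by (auto simp: F'_def)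
      show "disjoint_family_on (\<lambda>(c, d). {c<..<d}) (F \<union> insert (d, b) G)"
      proof -
        have 1: "{c<..<d} \<inter> (\<Union>(c, d)\<in>insert (d, b) (F' \<union> G). {c<..<d}) = {}"
          using cd' by (auto dest: le_c[OF UnI1] le_c[OF UnI2])
        have 2: "{d<..<b} \<inter> (\<Union>(c, d)\<in>F' \<union> G. {c<..<d}) = {}"
          using cd' by (auto dest: le_c[OF UnI1] le_c[OF UnI2])
        then show ?thesis
          unfolding eq disjoint_family_on_insert[OF new(1)] disjoint_family_on_insert[OF new(2)]
          using G(4) 1 2 by simp
      qed
      show "(\<Sum>(c, d)\<in>F \<union> insert (d, b) G. h d - h c) = h b - h a" for h :: "real \<Rightarrow> real"
      proof -
        have fin': "finite (F' \<union> G)" "finite (insert (d, b) (F' \<union> G))" using fin G(1) by (simp_all add: F'_def)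
        show ?thesis
          unfolding eq sum.insert[OF fin'(2) new(1)] sum.insert[OF fin'(1) new(2)] spec[OF sumG, of h] by simp
      qed
    qed
  qed
  then obtain G where G: "finite G" "\<forall>(c, d)\<in>G. a \<le> c \<and> c \<le> d \<and> d \<le> b" "F \<inter> G = {}"
    "disjoint_family_on (\<lambda>(c, d). {c<..<d}) (F \<union> G)"
    and h: "\<forall>h :: real \<Rightarrow> real. (\<Sum>(c, d)\<in>F \<union> G. h d - h c) = h b - h a"
    by (elim exE conjE)
  show thesis
    by (rule that[OF G(1) _ G(3,4) spec[OF h]]) (use G(2) in blast)
qed

text \<open>Vitali's theorem covers almost all of \<open>S\<close> by countably many disjoint
  intervals, and finitely many of them carry all but \<open>e\<close> of the total length. The
  conclusion about \<sigma> has the form of the hypothesis, so the lemma can be applied again to the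
  part of \<open>S\<close> that was caught.\<close>

lemma finite_Vitali_intervals:
  fixes U S :: "real set"
  assumes "open U" "U \<in> lmeasurable" "S \<subseteq> U"
    and \<sigma>: "\<And>M. M \<in> lmeasurable \<Longrightarrow> S \<subseteq> M \<Longrightarrow> \<sigma> \<le> measure lebesgue M"
    and cover: "\<And>x e. x \<in> S \<Longrightarrow> e > 0 \<Longrightarrow> \<exists>c d. c < d \<and> x \<in> {c..d} \<and> d - c < e \<and> P c d"
    and "e > 0"
  obtains F where "finite F" "\<And>c d. (c, d) \<in> F \<Longrightarrow> c < d \<and> {c..d} \<subseteq> U \<and> P c d"
    "disjoint_family_on (\<lambda>(c, d). {c..d}) F"
    "\<And>M. M \<in> lmeasurable \<Longrightarrow> S \<inter> (\<Union>(c, d)\<in>F. {c<..<d}) \<subseteq> M \<Longrightarrow> \<sigma> - e \<le> measure lebesgue M"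
proof -
  define K where "K = {(c, d). c < d \<and> {c..d} \<subseteq> U \<and> P c d}"
  let ?m = "\<lambda>p :: real \<times> real. (fst p + snd p) / 2" and ?r = "\<lambda>p :: real \<times> real. (snd p - fst p) / 2"
  let ?I = "\<lambda>p :: real \<times> real. {fst p..snd p}"
  have cb: "cball (?m p) (?r p) = ?I p" for p
    by (auto simp: cball_eq_atLeastAtMost field_simps)
  obtain C where C: "countable C" "C \<subseteq> K"
     "pairwise (\<lambda>i j. disjnt (cball (?m i) (?r i)) (cball (?m j) (?r j))) C"
     "negligible (S - (\<Union>i \<in> C. cball (?m i) (?r i)))"
  proof (rule Vitali_covering_theorem_cballs[of K ?r S ?m])
    show "0 < ?r i" if "i \<in> K" for i using that by (auto simp: K_def)
    fix x d :: real assume x: "x \<in> S" and "0 < d"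
    obtain \<rho> where \<rho>: "\<rho> > 0" "ball x \<rho> \<subseteq> U" using assms(1,3) x by (meson open_contains_ball subsetD)
    obtain c d' where cd: "c < d'" "x \<in> {c..d'}" "d' - c < min \<rho> d" "P c d'"
      using cover[OF x, of "min \<rho> d"] \<rho>(1) \<open>0 < d\<close> by auto
    have "{c..d'} \<subseteq> ball x \<rho>" using cd by (auto simp: dist_real_def)
    then have "(c, d') \<in> K" using cd \<rho>(2) by (auto simp: K_def)
    then show "\<exists>i. i \<in> K \<and> x \<in> cball (?m i) (?r i) \<and> ?r i < d"
      unfolding cb using cd \<open>0 < d\<close> by (intro exI[of _ "(c, d')"]) auto
  qed blast
  have CU: "?I p \<subseteq> U" if "p \<in> C" for p using subsetD[OF C(2) that] by (cases p) (simp add: K_def)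
  have lm: "X \<in> lmeasurable" if "X \<in> ?I ` C" for X
    using that lmeasurable_cbox[of "fst p" "snd p" for p :: "real \<times> real", unfolded box_real] by blast
  have B: "measure lebesgue (\<Union>D) \<le> measure lebesgue U" if "D \<subseteq> ?I ` C" "finite D" for D
  proof (rule measure_mono_fmeasurable)
    show "\<Union>D \<subseteq> U" using that CU by blast
    show "\<Union>D \<in> sets lebesgue" using that lm by (intro sets.finite_Union) auto
  qed fact
  obtain D where D: "D \<subseteq> ?I ` C" "finite D"
    "measure lebesgue (\<Union>(?I ` C)) - e < measure lebesgue (\<Union>D)"
    by (rule measure_countable_Union_approachable[of "?I ` C" e "measure lebesgue U"])
      (use C(1) \<open>e > 0\<close> lm B in auto)
  obtain F where F: "F \<subseteq> C" "finite F" "D = ?I ` F"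
    using finite_subset_image[OF D(2,1)] by blast
  show thesis
  proof
    show "finite F" by fact
    show "c < d \<and> {c..d} \<subseteq> U \<and> P c d" if "(c, d) \<in> F" for c d
      using subsetD[OF subset_trans[OF F(1) C(2)] that] by (simp add: K_def)
    show "disjoint_family_on (\<lambda>(c, d). {c..d}) F"
      unfolding disjoint_family_on_def
    proof (intro ballI impI)
      fix p q assume "p \<in> F" "q \<in> F" "p \<noteq> q"
      then have "disjnt (?I p) (?I q)"
        using pairwiseD[OF C(3)[unfolded cb], of p q] subsetD[OF F(1)] by simp
      then show "(case p of (c, d) \<Rightarrow> {c..d}) \<inter> (case q of (c, d) \<Rightarrow> {c..d}) = {}"
        by (simp only: split_beta disjnt_def)
    qed
    fix M assume M: "M \<in> lmeasurable" and sub: "S \<inter> (\<Union>(c, d)\<in>F. {c<..<d}) \<subseteq> M"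
    have UC: "\<Union>(?I ` C) \<in> lmeasurable"
      by (rule fmeasurableI2[OF assms(2)]) (use CU C(1) in \<open>auto intro!: sets.countable_UN''\<close>)
    have UD: "\<Union>D \<in> lmeasurable" using D(1,2) lm by blast
    \<comment> \<open>The conclusion speaks of open intervals, so the finitely many end points join
      the exceptional set.\<close>
    define N where "N = (S - \<Union>(?I ` C)) \<union> (fst ` F \<union> snd ` F)"
    have N: "negligible N"
      unfolding N_def using C(4) cb F(2) by (auto intro!: negligible_Un simp: negligible_finite)
    \<comment> \<open>What \<open>M\<close> misses lies in the discarded intervals, of total length
      below \<open>e\<close>, or in a null set.\<close>
    have "S \<subseteq> M \<union> (\<Union>(?I ` C) - \<Union>D) \<union> N"
    proof
      fix x assume x: "x \<in> S"
      show "x \<in> M \<union> (\<Union>(?I ` C) - \<Union>D) \<union> N"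
      proof (cases "x \<in> \<Union>D")
        case True
        then obtain c d where cd: "(c, d) \<in> F" "x \<in> {c..d}" using F(3) by auto
        then have "x \<in> {c<..<d} \<or> x = c \<or> x = d" by auto
        then show ?thesis
        proof
          assume "x \<in> {c<..<d}" then show ?thesis using sub x cd(1) by blast
        next
          assume "x = c \<or> x = d" then show ?thesis using cd(1) by (force simp: N_def)
        qed
      qed (auto simp: N_def x)
    qed
    moreover have meas: "M \<union> (\<Union>(?I ` C) - \<Union>D) \<union> N \<in> lmeasurable"
      by (rule fmeasurable.Un[OF fmeasurable.Un[OF M fmeasurable.Diff[OF UC UD]] negligible_imp_measurable[OF N]])
    ultimately have "\<sigma> \<le> measure lebesgue (M \<union> (\<Union>(?I ` C) - \<Union>D) \<union> N)"
      by (intro \<sigma>)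
    also have "\<dots> = measure lebesgue (M \<union> (\<Union>(?I ` C) - \<Union>D))"
      by (rule measure_Un_null_set) (use M UC UD N in \<open>auto simp: negligible_iff_null_sets fmeasurableD\<close>)
    also have "\<dots> \<le> measure lebesgue M + measure lebesgue (\<Union>(?I ` C) - \<Union>D)"
      using M UC UD by (intro measure_Un_le) (auto simp: fmeasurableD)
    also have "measure lebesgue (\<Union>(?I ` C) - \<Union>D) = measure lebesgue (\<Union>(?I ` C)) - measure lebesgue (\<Union>D)"
      by (rule measurable_measure_Diff) (use UC UD D(1) in \<open>auto simp: fmeasurableD\<close>)
    finally show "\<sigma> - e \<le> measure lebesgue M" using D(3) by linarith
  qed
qed

text \<open>\<sigma> is the outer measure of \<open>E\<close>, an infimum over measurable supersets.
  It is positive because \<open>E\<close> is not negligible; a nearly optimal superset, enlarged by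
  outer regularity, gives the open set.\<close>

lemma non_negligible_outer_open:
  fixes E :: "'a::euclidean_space set"
  assumes "bounded E" "\<not> negligible E"
  obtains \<sigma> where "\<sigma> > 0" "\<And>M. M \<in> lmeasurable \<Longrightarrow> E \<subseteq> M \<Longrightarrow> \<sigma> \<le> measure lebesgue M"
    "\<And>e. e > 0 \<Longrightarrow> \<exists>U. open U \<and> U \<in> lmeasurable \<and> E \<subseteq> U \<and> measure lebesgue U < \<sigma> + e"
proof
  let ?A = "{M \<in> lmeasurable. E \<subseteq> M}"
  let ?\<sigma> = "INF M\<in>?A. measure lebesgue M"
  obtain a where "E \<subseteq> cbox (-a) a" using assms(1) bounded_subset_cbox_symmetric by blast
  then have ne: "?A \<noteq> {}" using lmeasurable_cbox by blast
  have bdd: "bdd_below (measure lebesgue ` ?A)" by (rule bdd_belowI[of _ 0]) auto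
  show le: "?\<sigma> \<le> measure lebesgue M" if "M \<in> lmeasurable" "E \<subseteq> M" for M
    using that bdd by (intro cINF_lower) auto
  obtain e where "e > 0" "\<And>M. M \<in> ?A \<Longrightarrow> e \<le> measure lebesgue M"
    using assms(2) unfolding negligible_outer by (auto simp: not_less)
  then have "e \<le> ?\<sigma>" by (intro cINF_greatest ne)
  with \<open>e > 0\<close> show "?\<sigma> > 0" by linarith
  show "\<exists>U. open U \<and> U \<in> lmeasurable \<and> E \<subseteq> U \<and> measure lebesgue U < ?\<sigma> + e" if e: "e > 0" for e
  proof -
    have "\<exists>M\<in>?A. measure lebesgue M < ?\<sigma> + e / 2"
      using cINF_less_iff[OF ne bdd, of "?\<sigma> + e / 2"] that by simp
    then obtain M where M: "M \<in> lmeasurable" "E \<subseteq> M" "measure lebesgue M < ?\<sigma> + e / 2" by blast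
    obtain U where U: "open U" "M \<subseteq> U" "U - M \<in> lmeasurable" "emeasure lebesgue (U - M) < ennreal (e / 2)"
      by (rule sets_lebesgue_outer_open[OF fmeasurableD[OF M(1)], of "e / 2"]) (use e in auto)
    then have "U \<in> lmeasurable"
      using fmeasurable.Un[OF M(1) U(3)] by (simp add: Un_absorb1)
    moreover have "measure lebesgue U = measure lebesgue M + measure lebesgue (U - M)"
      using measurable_measure_Diff[OF \<open>U \<in> lmeasurable\<close> fmeasurableD[OF M(1)] U(2)] by simp
    moreover have "measure lebesgue (U - M) < e / 2"
      using U(3,4) that by (simp add: emeasure_eq_measure2 ennreal_less_iff)
    ultimately show ?thesis using U(1,2) M by (intro exI[of _ U]) auto
  qed
qed

lemma measure_finite_disjoint_intervals:
  fixes F :: "(real \<times> real) set"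
  assumes "finite F" "\<And>c d. (c, d) \<in> F \<Longrightarrow> c \<le> d" "disjoint_family_on (\<lambda>(c, d). {c..d}) F"
  shows "measure lebesgue (\<Union>(c, d)\<in>F. {c..d}) = (\<Sum>(c, d)\<in>F. d - c)"
    "measure lebesgue (\<Union>(c, d)\<in>F. {c<..<d}) = (\<Sum>(c, d)\<in>F. d - c)"
proof -
  have "measure lebesgue (\<Union>(c, d)\<in>F. {c..d}) = (\<Sum>p\<in>F. measure lebesgue (case p of (c, d) \<Rightarrow> {c..d}))"
    by (rule measure_finite_Union) (use assms in \<open>auto simp: emeasure_lborel_Icc_eq\<close>)
  also have "\<dots> = (\<Sum>(c, d)\<in>F. d - c)"
    by (rule sum.cong) (use assms(2) in auto)
  finally show "measure lebesgue (\<Union>(c, d)\<in>F. {c..d}) = (\<Sum>(c, d)\<in>F. d - c)" .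
  have dis: "disjoint_family_on (\<lambda>(c, d). {c<..<d}) F"
    using assms(3) unfolding disjoint_family_on_def by fastforce
  have "measure lebesgue (\<Union>(c, d)\<in>F. {c<..<d}) = (\<Sum>p\<in>F. measure lebesgue (case p of (c, d) \<Rightarrow> {c<..<d}))"
    by (rule measure_finite_Union) (use assms dis in auto)
  also have "\<dots> = (\<Sum>(c, d)\<in>F. d - c)"
    by (rule sum.cong) (use assms(2) in auto)
  finally show "measure lebesgue (\<Union>(c, d)\<in>F. {c<..<d}) = (\<Sum>(c, d)\<in>F. d - c)" .
qed

lemma absolutely_continuous_curveD:
  assumes "absolutely_continuous_curve a b \<zeta>" "\<epsilon> > 0"
  obtains \<delta> where "\<delta> > 0" "\<And>D. finite D \<Longrightarrow> (\<And>c d. (c, d) \<in> D \<Longrightarrow> a \<le> c \<and> c \<le> d \<and> d \<le> b) \<Longrightarrow>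
    disjoint_family_on (\<lambda>(c, d). {c<..<d}) D \<Longrightarrow> (\<Sum>(c, d)\<in>D. d - c) < \<delta> \<Longrightarrow>
    (\<Sum>(c, d)\<in>D. dist (\<zeta> c) (\<zeta> d)) < \<epsilon>"
proof -
  obtain \<delta> where \<delta>: "\<delta> > 0" "\<forall>D. finite D \<and> (\<forall>(c, d)\<in>D. a \<le> c \<and> c \<le> d \<and> d \<le> b) \<and>
      disjoint_family_on (\<lambda>(c, d). {c<..<d}) D \<and> (\<Sum>(c, d)\<in>D. d - c) < \<delta> \<longrightarrow>
      (\<Sum>(c, d)\<in>D. dist (\<zeta> c) (\<zeta> d)) < \<epsilon>"
    using assms unfolding absolutely_continuous_curve_def by meson
  show thesis
    by (rule that[OF \<delta>(1)]) (intro \<delta>(2)[rule_format] conjI, auto)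
qed

lemma disjoint_family_on_Ioo_of_Icc:
  fixes F :: "(real \<times> real) set"
  assumes "disjoint_family_on (\<lambda>(c, d). {c..d}) F"
  shows "disjoint_family_on (\<lambda>(c, d). {c<..<d}) F"
  using assms unfolding disjoint_family_on_def by fastforce

section \<open>Bad difference quotients of absolutely continuous functions\<close>

text \<open>If \<open>E\<close> had outer measure \<sigma> > 0, disjoint intervals \<open>F\<close>
  of slope at least \<beta> would cover it up to a small loss, and inside them disjoint intervals
  \<open>F'\<close> of slope at most \<alpha> would do so again. Both families have length close to
  \<sigma>, so their difference is short and, by absolute continuity, contributes almost no
  increment. Then nearly the same length has increment about \<beta> \<sigma> or more and about
  \<alpha> \<sigma> or less.\<close>

lemma negligible_crossing_slopes:
  fixes f :: "real \<Rightarrow> real"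
  assumes ac: "absolutely_continuous_curve a b f" and "\<alpha> < \<beta>" and E: "E \<subseteq> {a<..<b}"
    and up: "\<And>x e. x \<in> E \<Longrightarrow> e > 0 \<Longrightarrow> \<exists>c d. c < d \<and> x \<in> {c..d} \<and> d - c < e \<and> \<beta> * (d - c) \<le> f d - f c"
    and down: "\<And>x e. x \<in> E \<Longrightarrow> e > 0 \<Longrightarrow> \<exists>c d. c < d \<and> x \<in> {c..d} \<and> d - c < e \<and> f d - f c \<le> \<alpha> * (d - c)"
  shows "negligible E"
proof (rule ccontr)
  assume "\<not> negligible E"
  have "bounded E" by (rule bounded_subset[OF _ E]) simp
  obtain \<sigma> where \<sigma>: "\<sigma> > 0" "\<And>M. M \<in> lmeasurable \<Longrightarrow> E \<subseteq> M \<Longrightarrow> \<sigma> \<le> measure lebesgue M"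
    "\<And>e. e > 0 \<Longrightarrow> \<exists>U. open U \<and> U \<in> lmeasurable \<and> E \<subseteq> U \<and> measure lebesgue U < \<sigma> + e"
    using non_negligible_outer_open[OF \<open>bounded E\<close> \<open>\<not> negligible E\<close>] by metis
  \<comment> \<open>Chosen so that, with \<open>F\<close> of length at least 3/4 \<sigma>, the final
    contradiction reads 3 \<eta> < 2 \<eta>.\<close>
  define \<eta> where "\<eta> = (\<beta> - \<alpha>) * \<sigma> / 4"
  have "\<eta> > 0" using \<open>\<alpha> < \<beta>\<close> \<sigma>(1) by (simp add: \<eta>_def)
  obtain \<delta> where \<delta>: "\<delta> > 0" "\<And>D. finite D \<Longrightarrow> (\<And>c d. (c, d) \<in> D \<Longrightarrow> a \<le> c \<and> c \<le> d \<and> d \<le> b) \<Longrightarrow>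
    disjoint_family_on (\<lambda>(c, d). {c<..<d}) D \<Longrightarrow> (\<Sum>(c, d)\<in>D. d - c) < \<delta> \<Longrightarrow>
    (\<Sum>(c, d)\<in>D. dist (f c) (f d)) < \<eta>"
    using absolutely_continuous_curveD[OF ac \<open>\<eta> > 0\<close>] by metis
  \<comment> \<open>The three bounds serve in turn to make the part of \<open>F\<close> missed by
    \<open>F'\<close>, of length at most 3 e, shorter than \<delta>; to keep the length of
    \<open>F\<close> above 3/4 \<sigma>; and to bound the error caused by the different lengths of
    \<open>F\<close> and \<open>F'\<close> by \<eta>.\<close>
  define e where "e = Min {\<delta> / 4, \<sigma> / 4, \<eta> / (3 * (\<bar>\<alpha>\<bar> + 1))}"
  have e: "e > 0" "e \<le> \<delta> / 4" "e \<le> \<sigma> / 4" "e \<le> \<eta> / (3 * (\<bar>\<alpha>\<bar> + 1))"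
  proof -
    show "e > 0" using \<delta>(1) \<sigma>(1) \<open>\<eta> > 0\<close> by (simp add: e_def)
    show "e \<le> \<delta> / 4" "e \<le> \<sigma> / 4" "e \<le> \<eta> / (3 * (\<bar>\<alpha>\<bar> + 1))"
      unfolding e_def by (rule Min_le, simp, simp)+
  qed
  then have e4: "3 * e * \<bar>\<alpha>\<bar> \<le> \<eta>"
  proof -
    have "3 * e * \<bar>\<alpha>\<bar> \<le> e * (3 * (\<bar>\<alpha>\<bar> + 1))" using e(1) by (simp add: algebra_simps)
    also have "\<dots> \<le> \<eta>" using e(4) by (simp add: pos_le_divide_eq)
    finally show ?thesis .
  qed
  obtain U0 where U0: "open U0" "U0 \<in> lmeasurable" "E \<subseteq> U0" "measure lebesgue U0 < \<sigma> + e"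
    using \<sigma>(3)[OF e(1)] by blast
  define U where "U = U0 \<inter> {a<..<b}"
  have U: "open U" "U \<in> lmeasurable" "E \<subseteq> U" "U \<subseteq> {a<..<b}"
    using U0 E by (auto simp: U_def fmeasurable_Int_fmeasurable)
  have "measure lebesgue U \<le> measure lebesgue U0"
    by (rule measure_mono_fmeasurable) (use U0 U in \<open>auto simp: U_def fmeasurableD\<close>)
  then have mU: "measure lebesgue U < \<sigma> + e" using U0(4) by linarith
  obtain F where F: "finite F"
    "\<And>c d. (c, d) \<in> F \<Longrightarrow> c < d \<and> {c..d} \<subseteq> U \<and> \<beta> * (d - c) \<le> f d - f c"
    "disjoint_family_on (\<lambda>(c, d). {c..d}) F"
    and \<sigma>F: "\<And>M. M \<in> lmeasurable \<Longrightarrow> E \<inter> (\<Union>(c, d)\<in>F. {c<..<d}) \<subseteq> M \<Longrightarrow> \<sigma> - e \<le> measure lebesgue M"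
    by (rule finite_Vitali_intervals[OF U(1-3) \<sigma>(2), where P = "\<lambda>c d. \<beta> * (d - c) \<le> f d - f c" and e = e])
      (assumption, assumption, erule (1) up, rule e(1), rule that, assumption+)
  define U' where "U' = (\<Union>(c, d)\<in>F. {c<..<d})"
  have U': "open U'" "U' \<in> lmeasurable" "E \<inter> U' \<subseteq> U'"
    unfolding U'_def using F(1) by (auto intro!: fmeasurable.finite_UN)
  have down': "\<And>x e. x \<in> E \<inter> U' \<Longrightarrow> e > 0 \<Longrightarrow> \<exists>c d. c < d \<and> x \<in> {c..d} \<and> d - c < e \<and> f d - f c \<le> \<alpha> * (d - c)"
    using down by blast
  obtain F' where F': "finite F'"
    "\<And>c d. (c, d) \<in> F' \<Longrightarrow> c < d \<and> {c..d} \<subseteq> U' \<and> f d - f c \<le> \<alpha> * (d - c)"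
    "disjoint_family_on (\<lambda>(c, d). {c..d}) F'"
    and \<sigma>F': "\<And>M. M \<in> lmeasurable \<Longrightarrow> E \<inter> U' \<inter> (\<Union>(c, d)\<in>F'. {c<..<d}) \<subseteq> M \<Longrightarrow> \<sigma> - e - e \<le> measure lebesgue M"
    by (rule finite_Vitali_intervals[OF U' \<sigma>F[folded U'_def], where P = "\<lambda>c d. f d - f c \<le> \<alpha> * (d - c)" and e = e])
      (assumption, assumption, erule (1) down', rule e(1), rule that, assumption+)
  have le: "\<And>c d. (c, d) \<in> F \<Longrightarrow> c \<le> d" "\<And>c d. (c, d) \<in> F' \<Longrightarrow> c \<le> d"
    using F(2) F'(2) by (meson less_imp_le)+
  define l where "l = (\<Sum>(c, d)\<in>F. d - c)"
  define l' where "l' = (\<Sum>(c, d)\<in>F'. d - c)"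
  have "\<sigma> - e - e \<le> measure lebesgue (\<Union>(c, d)\<in>F'. {c<..<d})"
    by (rule \<sigma>F') (use F'(1) in \<open>auto intro!: fmeasurable.finite_UN\<close>)
  also have "\<dots> = l'" unfolding l'_def by (rule measure_finite_disjoint_intervals[OF F'(1) le(2) F'(3)])
  finally have l': "\<sigma> - 2 * e \<le> l'" by simp
  have "\<sigma> - e \<le> measure lebesgue U'"
    by (rule \<sigma>F[folded U'_def]) (use U' in auto)
  also have mU': "\<dots> = l" unfolding l_def U'_def by (rule measure_finite_disjoint_intervals[OF F(1) le(1) F(3)])
  finally have l: "\<sigma> - e \<le> l" .
  have "l \<le> measure lebesgue U" unfolding mU'[symmetric]
  proof (rule measure_mono_fmeasurable)
    show "U' \<subseteq> U" unfolding U'_def using F(2) by (force simp: subset_iff)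
  qed (use U U' in \<open>auto simp: fmeasurableD\<close>)
  then have ll: "l < \<sigma> + e" using mU by linarith
  have Fab: "a \<le> c \<and> c < d \<and> d \<le> b" if "(c, d) \<in> F" for c d
  proof -
    have "c < d" "{c..d} \<subseteq> {a<..<b}" using F(2)[OF that] U(4) by (simp, blast)
    moreover from this have "c \<in> {a<..<b}" "d \<in> {a<..<b}" by (auto simp: subset_iff)
    ultimately show ?thesis by auto
  qed
  have "E \<noteq> {}" using \<open>\<not> negligible E\<close> by auto
  then have "a \<le> b" using E by auto
  obtain G where G: "finite G" "\<And>c d. (c, d) \<in> G \<Longrightarrow> a \<le> c \<and> c \<le> d \<and> d \<le> b" "F \<inter> G = {}"
    "disjoint_family_on (\<lambda>(c, d). {c<..<d}) (F \<union> G)"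
    "\<And>h :: real \<Rightarrow> real. (\<Sum>(c, d)\<in>F \<union> G. h d - h c) = h b - h a"
    using interval_gaps[OF F(1) \<open>a \<le> b\<close> Fab disjoint_family_on_Ioo_of_Icc[OF F(3)]] by metis
  \<comment> \<open>\<open>interval_gaps\<close> is applied a second time, to \<open>F'\<close>
    together with the gaps of \<open>F\<close>, and accepts nondegenerate intervals only.\<close>
  define G0 where "G0 = {p \<in> G. fst p < snd p}"
  have G0: "finite G0" "G0 \<subseteq> G" "\<And>c d. (c, d) \<in> G0 \<Longrightarrow> a \<le> c \<and> c < d \<and> d \<le> b"
    using G(1,2) by (auto simp: G0_def)
  have sumG0: "(\<Sum>(c, d)\<in>G0. h d - h c) = h b - h a - (\<Sum>(c, d)\<in>F. h d - h c)" for h :: "real \<Rightarrow> real"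
  proof -
    have "(\<Sum>(c, d)\<in>G0. h d - h c) = (\<Sum>(c, d)\<in>G. h d - h c)"
      using G(1,2) by (intro sum.mono_neutral_left) (force simp: G0_def)+
    also have "\<dots> = (\<Sum>(c, d)\<in>F \<union> G. h d - h c) - (\<Sum>(c, d)\<in>F. h d - h c)"
      by (subst sum.union_disjoint) (use G F(1) in auto)
    finally show ?thesis using G(5) by simp
  qed
  have G0U': "{c<..<d} \<inter> U' = {}" if "(c, d) \<in> G0" for c d
  proof -
    have "{c<..<d} \<inter> {c'<..<d'} = {}" if "(c', d') \<in> F" for c' d'
      using disjoint_family_onD[OF G(4), of "(c, d)" "(c', d')"] that \<open>(c, d) \<in> G0\<close> G0(2) G(3) by auto
    then show ?thesis unfolding U'_def by blast
  qed
  have F'U': "{c<..<d} \<subseteq> U'" if "(c, d) \<in> F'" for c d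
    using F'(2)[OF that] by (meson greaterThanLessThan_subseteq_atLeastAtMost_iff order_refl order_trans)
  have FG: "F' \<inter> G0 = {}"
  proof (rule ccontr)
    assume "F' \<inter> G0 \<noteq> {}"
    then obtain c d where "(c, d) \<in> F'" "(c, d) \<in> G0" by auto
    then show False using F'U' G0U' F'(2)[of c d] dense[of c d] by fastforce
  qed
  have Fab': "a \<le> c \<and> c < d \<and> d \<le> b" if "(c, d) \<in> F' \<union> G0" for c d
  proof (cases "(c, d) \<in> F'")
    case True
    have "U' \<subseteq> {a<..<b}" unfolding U'_def using Fab by fastforce
    then have "c < d" "{c..d} \<subseteq> {a<..<b}" using F'(2)[OF True] by (simp, blast)
    moreover from this have "c \<in> {a<..<b}" "d \<in> {a<..<b}" by (auto simp: subset_iff)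
    ultimately show ?thesis by auto
  qed (use that G0(3) in auto)
  have dis: "disjoint_family_on (\<lambda>(c, d). {c<..<d}) (F' \<union> G0)"
    unfolding disjoint_family_on_def
  proof (intro ballI impI)
    fix p q assume pq: "p \<in> F' \<union> G0" "q \<in> F' \<union> G0" "p \<noteq> q"
    obtain c d c' d' where [simp]: "p = (c, d)" "q = (c', d')" by fastforce
    have FG': "{c<..<d} \<inter> {c'<..<d'} = {}" if "(c, d) \<in> F'" "(c', d') \<in> G0" for c d c' d'
    proof -
      have "{c<..<d} \<inter> {c'<..<d'} \<subseteq> {c'<..<d'} \<inter> U'" using F'U'[OF that(1)] by blast
      then show ?thesis unfolding G0U'[OF that(2)] by (rule subset_empty[THEN iffD1])
    qed
    consider "p \<in> F'" "q \<in> F'" | "p \<in> F'" "q \<in> G0" | "p \<in> G0" "q \<in> F'" | "p \<in> G0" "q \<in> G0"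
      using pq by blast
    then have "{c<..<d} \<inter> {c'<..<d'} = {}"
    proof cases
      case 1
      then show ?thesis
        using disjoint_family_onD[OF disjoint_family_on_Ioo_of_Icc[OF F'(3)] _ _ pq(3)] by simp
    next
      case 2 then show ?thesis using FG' by simp
    next
      case 3 then show ?thesis unfolding Int_commute[of "{c<..<d}"] using FG' by simp
    next
      case 4
      then show ?thesis using disjoint_family_onD[OF G(4), of p q] pq(3) G0(2) by auto
    qed
    then show "(case p of (c, d) \<Rightarrow> {c<..<d}) \<inter> (case q of (c, d) \<Rightarrow> {c<..<d}) = {}" by simp
  qed
  \<comment> \<open>The gaps of \<open>F'\<close> and \<open>G0\<close> together are the part of
    \<open>F\<close> left free by \<open>F'\<close>; \<open>sumR\<close> records this for every
    \<open>h\<close>.\<close>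
  obtain R where R: "finite R" "\<And>c d. (c, d) \<in> R \<Longrightarrow> a \<le> c \<and> c \<le> d \<and> d \<le> b" "(F' \<union> G0) \<inter> R = {}"
    "disjoint_family_on (\<lambda>(c, d). {c<..<d}) ((F' \<union> G0) \<union> R)"
    "\<And>h :: real \<Rightarrow> real. (\<Sum>(c, d)\<in>(F' \<union> G0) \<union> R. h d - h c) = h b - h a"
    using interval_gaps[OF _ \<open>a \<le> b\<close> Fab' dis] F'(1) G0(1) by (metis finite_Un)
  have sumR: "(\<Sum>(c, d)\<in>R. h d - h c) = (\<Sum>(c, d)\<in>F. h d - h c) - (\<Sum>(c, d)\<in>F'. h d - h c)"
    for h :: "real \<Rightarrow> real"
  proof -
    have "h b - h a = (\<Sum>(c, d)\<in>F' \<union> G0. h d - h c) + (\<Sum>(c, d)\<in>R. h d - h c)"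
      unfolding R(5)[symmetric] by (rule sum.union_disjoint) (use F'(1) G0(1) R in auto)
    also have "(\<Sum>(c, d)\<in>F' \<union> G0. h d - h c) = (\<Sum>(c, d)\<in>F'. h d - h c) + (\<Sum>(c, d)\<in>G0. h d - h c)"
      by (rule sum.union_disjoint) (use F'(1) G0(1) FG in auto)
    finally show ?thesis using sumG0[of h] by simp
  qed
  have "(\<Sum>(c, d)\<in>R. dist (f c) (f d)) < \<eta>"
  proof (rule \<delta>(2)[OF R(1,2)])
    show "disjoint_family_on (\<lambda>(c, d). {c<..<d}) R"
      by (rule disjoint_family_on_mono[OF _ R(4)]) auto
    show "(\<Sum>(c, d)\<in>R. d - c) < \<delta>"
      using sumR[of "\<lambda>x. x"] l' ll e(1,2) by (simp add: l_def l'_def)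
  qed
  moreover have "(\<Sum>(c, d)\<in>R. f d - f c) \<le> (\<Sum>(c, d)\<in>R. dist (f c) (f d))"
    by (rule sum_mono) (auto simp: dist_real_def)
  moreover have "\<beta> * l \<le> (\<Sum>(c, d)\<in>F. f d - f c)"
    unfolding l_def sum_distrib_left by (rule sum_mono) (use F(2) in auto)
  moreover have "(\<Sum>(c, d)\<in>F'. f d - f c) \<le> \<alpha> * l'"
    unfolding l'_def sum_distrib_left by (rule sum_mono) (use F'(2) in auto)
  ultimately have "\<beta> * l - \<alpha> * l' < \<eta>" using sumR[of f] by linarith
  moreover have "\<alpha> * (l' - l) \<le> \<bar>\<alpha>\<bar> * (3 * e)"
  proof -
    have "(\<Sum>(c, d)\<in>R. d - c) \<ge> 0" by (rule sum_nonneg) (use R(2) in auto)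
    then have "\<bar>l' - l\<bar> \<le> 3 * e" using sumR[of "\<lambda>x. x"] l' ll by (simp add: l_def l'_def)
    then have "\<bar>\<alpha>\<bar> * \<bar>l' - l\<bar> \<le> \<bar>\<alpha>\<bar> * (3 * e)" by (intro mult_left_mono) auto
    then show ?thesis by (metis abs_le_D1 abs_mult)
  qed
  ultimately have "(\<beta> - \<alpha>) * l < 2 * \<eta>" using e4 by (simp add: algebra_simps)
  moreover have "(\<beta> - \<alpha>) * (3 / 4 * \<sigma>) \<le> (\<beta> - \<alpha>) * l"
    using l e(3) \<open>\<alpha> < \<beta>\<close> by (intro mult_left_mono) auto
  moreover have "(\<beta> - \<alpha>) * (3 / 4 * \<sigma>) = 3 * \<eta>" by (simp add: \<eta>_def)
  ultimately show False using \<open>\<eta> > 0\<close> by linarith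
qed

text \<open>In a ball of radius \<delta>/3 every disjoint family is shorter than \<delta>, so its
  increments sum to less than 1. If the part of \<open>E\<close> there had outer measure \<sigma> >
  0, disjoint intervals of slope at least 2/\<sigma> and total length at least \<sigma>/2 would have
  increments summing to at least 1.\<close>

lemma negligible_infinite_slopes:
  fixes f :: "real \<Rightarrow> real"
  assumes ac: "absolutely_continuous_curve a b f" and E: "E \<subseteq> {a<..<b}"
    and slope: "\<And>K x e. x \<in> E \<Longrightarrow> e > 0 \<Longrightarrow> \<exists>c d. c < d \<and> x \<in> {c..d} \<and> d - c < e \<and> K * (d - c) \<le> \<bar>f d - f c\<bar>"
  shows "negligible E"
proof -
  obtain \<delta> where \<delta>: "\<delta> > 0" "\<And>D. finite D \<Longrightarrow> (\<And>c d. (c, d) \<in> D \<Longrightarrow> a \<le> c \<and> c \<le> d \<and> d \<le> b) \<Longrightarrow>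
    disjoint_family_on (\<lambda>(c, d). {c<..<d}) D \<Longrightarrow> (\<Sum>(c, d)\<in>D. d - c) < \<delta> \<Longrightarrow>
    (\<Sum>(c, d)\<in>D. dist (f c) (f d)) < 1"
    using absolutely_continuous_curveD[OF ac zero_less_one] by metis
  have "negligible (E \<inter> ball z (\<delta> / 3))" for z
  proof (rule ccontr)
    let ?E = "E \<inter> ball z (\<delta> / 3)"
    assume "\<not> negligible ?E"
    have "bounded ?E" by (rule bounded_subset[OF bounded_ball]) auto
    obtain \<sigma> where \<sigma>: "\<sigma> > 0" "\<And>M. M \<in> lmeasurable \<Longrightarrow> ?E \<subseteq> M \<Longrightarrow> \<sigma> \<le> measure lebesgue M"
      using non_negligible_outer_open[OF \<open>bounded ?E\<close> \<open>\<not> negligible ?E\<close>] by metis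
    define U where "U = ball z (\<delta> / 3) \<inter> {a<..<b}"
    have U: "open U" "U \<in> lmeasurable" "?E \<subseteq> U"
      using E by (auto simp: U_def fmeasurable_Int_fmeasurable)
    have "measure lebesgue U \<le> measure lebesgue (ball z (\<delta> / 3))"
      by (rule measure_mono_fmeasurable) (use U in \<open>auto simp: U_def fmeasurableD\<close>)
    also have "\<dots> = 2 * \<delta> / 3"
      using \<delta>(1) by (simp add: ball_eq_greaterThanLessThan)
    finally have mU: "measure lebesgue U < \<delta>" using \<delta>(1) by linarith
    have cover: "\<And>x e. x \<in> ?E \<Longrightarrow> e > 0 \<Longrightarrow> \<exists>c d. c < d \<and> x \<in> {c..d} \<and> d - c < e \<and> 2 / \<sigma> * (d - c) \<le> \<bar>f d - f c\<bar>"
      using slope by blast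
    obtain F where F: "finite F"
      "\<And>c d. (c, d) \<in> F \<Longrightarrow> c < d \<and> {c..d} \<subseteq> U \<and> 2 / \<sigma> * (d - c) \<le> \<bar>f d - f c\<bar>"
      "disjoint_family_on (\<lambda>(c, d). {c..d}) F"
      and \<sigma>F: "\<And>M. M \<in> lmeasurable \<Longrightarrow> ?E \<inter> (\<Union>(c, d)\<in>F. {c<..<d}) \<subseteq> M \<Longrightarrow> \<sigma> - \<sigma> / 2 \<le> measure lebesgue M"
      by (rule finite_Vitali_intervals[OF U \<sigma>(2), where P = "\<lambda>c d. 2 / \<sigma> * (d - c) \<le> \<bar>f d - f c\<bar>" and e = "\<sigma> / 2"])
        (assumption, assumption, erule (1) cover, simp add: \<sigma>(1), rule that, assumption+)
    have le: "\<And>c d. (c, d) \<in> F \<Longrightarrow> c \<le> d" using F(2) by (meson less_imp_le)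
    define l where "l = (\<Sum>(c, d)\<in>F. d - c)"
    have ml: "measure lebesgue (\<Union>(c, d)\<in>F. {c<..<d}) = l"
      unfolding l_def by (rule measure_finite_disjoint_intervals[OF F(1) le F(3)])
    have "\<sigma> - \<sigma> / 2 \<le> measure lebesgue (\<Union>(c, d)\<in>F. {c<..<d})"
      by (rule \<sigma>F) (use F(1) in \<open>auto intro!: fmeasurable.finite_UN\<close>)
    then have l: "\<sigma> / 2 \<le> l" using ml by simp
    have "l \<le> measure lebesgue U" unfolding ml[symmetric]
    proof (rule measure_mono_fmeasurable)
      show "(\<Union>(c, d)\<in>F. {c<..<d}) \<subseteq> U" using F(2) by (force simp: subset_iff)
    qed (use U F(1) in \<open>auto simp: fmeasurableD\<close>)
    then have "(\<Sum>(c, d)\<in>F. dist (f c) (f d)) < 1"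
    proof (intro \<delta>(2))
      show "a \<le> c \<and> c \<le> d \<and> d \<le> b" if "(c, d) \<in> F" for c d
      proof -
        have "c < d" "c \<in> U" "d \<in> U" using F(2)[OF that] by auto
        then show ?thesis by (auto simp: U_def)
      qed
    qed (use F mU in \<open>auto simp: l_def intro: disjoint_family_on_Ioo_of_Icc\<close>)
    moreover have "2 / \<sigma> * l \<le> (\<Sum>(c, d)\<in>F. dist (f c) (f d))"
      unfolding l_def sum_distrib_left by (rule sum_mono) (use F(2) in \<open>auto simp: dist_real_def abs_minus_commute\<close>)
    moreover have "2 / \<sigma> * (\<sigma> / 2) \<le> 2 / \<sigma> * l" using l \<sigma>(1) by (intro mult_left_mono) auto
    moreover have "2 / \<sigma> * (\<sigma> / 2) = 1" using \<sigma>(1) by simp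
    ultimately show False by linarith
  qed
  then show ?thesis
    unfolding locally_negligible_alt[of E]
    using \<delta>(1) by (metis centre_in_ball divide_pos_pos IntI openin_open_Int open_ball zero_less_numeral)
qed

text \<open>A difference quotient is symmetric in its two points, so \<open>x\<close> becomes the
  left or the right end of the interval according to the sign of \<open>h\<close>. This turns
  statements about two-sided quotients into Vitali covers.\<close>

lemma frequently_slope_imp_interval:
  fixes f :: "real \<Rightarrow> real"
  assumes "\<exists>\<^sub>F h in at 0. P ((f (x + h) - f x) / h)" "e > 0"
  obtains c d where "c < d" "x \<in> {c..d}" "d - c < e" "P ((f d - f c) / (d - c))"
proof -
  have "\<exists>h. h \<noteq> 0 \<and> \<bar>h\<bar> < e \<and> P ((f (x + h) - f x) / h)"
    using assms unfolding frequently_at by (force simp: dist_real_def)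
  then obtain h where h: "h \<noteq> 0" "\<bar>h\<bar> < e" "P ((f (x + h) - f x) / h)" by blast
  show thesis
  proof (cases "h > 0")
    case True
    then show ?thesis using h by (intro that[of x "x + h"]) auto
  next
    case False
    have "(f x - f (x + h)) / (x - (x + h)) = (f (x + h) - f x) / h"
      using h(1) by (simp add: field_simps)
    then show ?thesis using h False by (intro that[of "x + h" x]) auto
  qed
qed

text \<open>Where the limit does not exist, either the quotients are unbounded, which is the set
  \<open>N\<close>, or their lower limit is strictly below their upper limit. Two rationals then
  separate the limits, which leaves countably many sets \<open>E q\<close>.\<close>

lemma absolutely_continuous_differentiable_ae:
  fixes f :: "real \<Rightarrow> real"
  assumes ac: "absolutely_continuous_curve a b f"
  shows "negligible {t \<in> {a<..<b}. \<not> (\<exists>l. ((\<lambda>h. (f (t + h) - f t) / h) \<longlongrightarrow> l) (at 0))}"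
proof -
  define s where "s = (\<lambda>t h. (f (t + h) - f t) / h)"
  define E where "E = (\<lambda>(\<alpha> :: real, \<beta> :: real). {t \<in> {a<..<b}. (\<exists>\<^sub>F h in at 0. s t h \<le> \<alpha>) \<and> (\<exists>\<^sub>F h in at 0. \<beta> \<le> s t h)})"
  define N where "N = {t \<in> {a<..<b}. \<forall>K. \<exists>\<^sub>F h in at 0. K \<le> \<bar>s t h\<bar>}"
  define Q where "Q = {(\<alpha> :: real, \<beta>). \<alpha> \<in> \<rat> \<and> \<beta> \<in> \<rat> \<and> \<alpha> < \<beta>}"
  have "countable Q"
    by (rule countable_subset[of _ "\<rat> \<times> \<rat>"]) (auto simp: Q_def countable_rat)
  have negE: "negligible (E (\<alpha>, \<beta>))" if "\<alpha> < \<beta>" for \<alpha> \<beta>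
  proof (rule negligible_crossing_slopes[OF ac that])
    fix x e :: real assume x: "x \<in> E (\<alpha>, \<beta>)" and "e > 0"
    obtain c d where "c < d" "x \<in> {c..d}" "d - c < e" "\<beta> \<le> (f d - f c) / (d - c)"
      by (rule frequently_slope_imp_interval[of "\<lambda>r. \<beta> \<le> r" f x e])
        (use x \<open>e > 0\<close> in \<open>auto simp: E_def s_def\<close>)
    then show "\<exists>c d. c < d \<and> x \<in> {c..d} \<and> d - c < e \<and> \<beta> * (d - c) \<le> f d - f c"
      by (intro exI[of _ c] exI[of _ d]) (simp add: pos_le_divide_eq)
    obtain c d where "c < d" "x \<in> {c..d}" "d - c < e" "(f d - f c) / (d - c) \<le> \<alpha>"
      by (rule frequently_slope_imp_interval[of "\<lambda>r. r \<le> \<alpha>" f x e])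
        (use x \<open>e > 0\<close> in \<open>auto simp: E_def s_def\<close>)
    then show "\<exists>c d. c < d \<and> x \<in> {c..d} \<and> d - c < e \<and> f d - f c \<le> \<alpha> * (d - c)"
      by (intro exI[of _ c] exI[of _ d]) (simp add: pos_divide_le_eq)
  qed (auto simp: E_def)
  have negN: "negligible N"
  proof (rule negligible_infinite_slopes[OF ac])
    fix K x e :: real assume x: "x \<in> N" and "e > 0"
    obtain c d where "c < d" "x \<in> {c..d}" "d - c < e" "K \<le> \<bar>(f d - f c) / (d - c)\<bar>"
      by (rule frequently_slope_imp_interval[of "\<lambda>r. K \<le> \<bar>r\<bar>" f x e])
        (use x \<open>e > 0\<close> in \<open>auto simp: N_def s_def\<close>)
    then show "\<exists>c d. c < d \<and> x \<in> {c..d} \<and> d - c < e \<and> K * (d - c) \<le> \<bar>f d - f c\<bar>"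
      by (intro exI[of _ c] exI[of _ d]) (simp add: pos_le_divide_eq)
  qed (auto simp: N_def)
  have "{t \<in> {a<..<b}. \<not> (\<exists>l. (s t \<longlongrightarrow> l) (at 0))} \<subseteq> N \<union> (\<Union>q\<in>Q. E q)"
  proof (rule subsetI, rule ccontr)
    fix t assume t: "t \<in> {t \<in> {a<..<b}. \<not> (\<exists>l. (s t \<longlongrightarrow> l) (at 0))}"
      and nt: "t \<notin> N \<union> (\<Union>q\<in>Q. E q)"
    have "t \<notin> N" using nt by blast
    then obtain K where K: "eventually (\<lambda>h. \<bar>s t h\<bar> < K) (at 0)"
      using t by (auto simp: N_def not_frequently not_le)
    let ?S = "\<lambda>h. ereal (s t h)"
    define u where "u = Limsup (at 0) ?S"
    define l where "l = Liminf (at 0) ?S"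
    have nt0: "at (0 :: real) \<noteq> bot" by simp
    have lu: "l \<le> u" unfolding l_def u_def by (rule Liminf_le_Limsup) simp
    have "u \<le> ereal K" unfolding u_def
      by (rule Limsup_bounded) (use K in \<open>auto elim!: eventually_mono\<close>)
    have "ereal (- K) \<le> l" unfolding l_def
      by (rule Liminf_bounded) (use K in \<open>auto elim!: eventually_mono\<close>)
    have "l = u"
    proof (rule ccontr)
      assume "l \<noteq> u"
      then have "l < u" using lu by simp
      \<comment> \<open>The auxiliary reals \<open>m'\<close> and \<open>m\<close> separate the
        rationals: m' < \<alpha> < m < \<beta>.\<close>
      obtain m where m: "l < ereal m" "ereal m < u" using ereal_dense2[OF \<open>l < u\<close>] by blast
      obtain m' where m': "l < ereal m'" "ereal m' < ereal m" using ereal_dense2[OF m(1)] by blast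
      obtain \<beta> where \<beta>: "\<beta> \<in> \<rat>" "m < \<beta>" "ereal \<beta> < u"
        using ereal_dense2[OF m(2)] Rats_dense_in_real by (metis less_ereal.simps(1) less_trans)
      obtain \<alpha> where \<alpha>: "\<alpha> \<in> \<rat>" "m' < \<alpha>" "\<alpha> < m" using Rats_dense_in_real m'(2) by auto
      have "\<exists>\<^sub>F h in at 0. s t h \<le> \<alpha>"
      proof (rule ccontr)
        assume "\<not> ?thesis"
        then have "eventually (\<lambda>h. ereal \<alpha> \<le> ?S h) (at 0)"
          by (auto simp: not_frequently elim!: eventually_mono)
        then have "ereal \<alpha> \<le> l" unfolding l_def by (rule Liminf_bounded)
        then show False using m'(1) \<alpha>(2) by (metis less_ereal.simps(1) less_le_trans less_trans less_irrefl)
      qed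
      moreover have "\<exists>\<^sub>F h in at 0. \<beta> \<le> s t h"
      proof (rule ccontr)
        assume "\<not> ?thesis"
        then have "eventually (\<lambda>h. ?S h \<le> ereal \<beta>) (at 0)"
          by (auto simp: not_frequently elim!: eventually_mono)
        then have "u \<le> ereal \<beta>" unfolding u_def by (rule Limsup_bounded)
        then show False using \<beta>(3) by simp
      qed
      ultimately have "t \<in> E (\<alpha>, \<beta>)" "(\<alpha>, \<beta>) \<in> Q"
        using t \<alpha> \<beta> by (auto simp: E_def Q_def)
      then show False using nt by blast
    qed
    moreover obtain r where "u = ereal r"
      using \<open>u \<le> ereal K\<close> \<open>ereal (- K) \<le> l\<close> lu by (cases u) auto
    ultimately have "(?S \<longlongrightarrow> ereal r) (at 0)"
      using tendsto_iff_Liminf_eq_Limsup[OF nt0, of ?S "ereal r"] by (simp add: l_def u_def)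
    then have "(s t \<longlongrightarrow> r) (at 0)" by simp
    then show False using t by blast
  qed
  moreover have "negligible (N \<union> (\<Union>q\<in>Q. E q))"
    using negN negE \<open>countable Q\<close> by (intro negligible_Un negligible_countable_Union) (auto simp: Q_def)
  ultimately show ?thesis
    unfolding s_def by (rule negligible_subset[rotated])
qed

text \<open>Lebesgue's differentiation theorem: by Henstock's lemma, disjoint small intervals on which
  the increment of the integral deviates from the tag value times the length carry little mass.\<close>

lemma integral_has_derivative_ae:
  fixes f :: "real \<Rightarrow> real"
  assumes int: "f integrable_on {a..b}"
  shows "negligible {t \<in> {a<..<b}. \<not> ((\<lambda>h. (integral {a..t + h} f - integral {a..t} f) / h) \<longlongrightarrow> f t) (at 0)}"
proof -
  define s where "s = (\<lambda>t h. (integral {a..t + h} f - integral {a..t} f) / h)"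
  define E where "E = (\<lambda>k. {t \<in> {a<..<b}. \<exists>\<^sub>F h in at 0. k \<le> \<bar>s t h - f t\<bar>})"
  have negE: "negligible (E k)" if "k > 0" for k
  proof (rule ccontr)
    assume "\<not> negligible (E k)"
    have Eab: "E k \<subseteq> {a<..<b}" by (auto simp: E_def)
    have "bounded (E k)" by (rule bounded_subset[OF _ Eab]) simp
    obtain \<sigma> where \<sigma>: "\<sigma> > 0" "\<And>M. M \<in> lmeasurable \<Longrightarrow> E k \<subseteq> M \<Longrightarrow> \<sigma> \<le> measure lebesgue M"
      using non_negligible_outer_open[OF \<open>bounded (E k)\<close> \<open>\<not> negligible (E k)\<close>] by metis
    \<comment> \<open>The bound is exactly what intervals of total length at least \<sigma>/2, each
      deviating by at least \<open>k\<close> times its length, would violate.\<close>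
    obtain \<gamma> where \<gamma>: "gauge \<gamma>"
      "\<And>p. p tagged_partial_division_of cbox a b \<Longrightarrow> \<gamma> fine p \<Longrightarrow>
        (\<Sum>(x, K)\<in>p. norm (measure lborel K *\<^sub>R f x - integral K f)) < k * (\<sigma> / 2)"
      using Henstock_lemma[of f a b "k * (\<sigma> / 2)"] int \<open>k > 0\<close> \<sigma>(1) by (auto simp: box_real)
    \<comment> \<open>The covering lemma does not remember which point produced an interval, so the
      tag is hidden here under a quantifier and recovered by choice afterwards.\<close>
    define P where "P = (\<lambda>c d. \<exists>x\<in>{c..d}. {c..d} \<subseteq> \<gamma> x \<and> k * (d - c) \<le> \<bar>(d - c) * f x - integral {c..d} f\<bar>)"
    have cover: "\<exists>c d. c < d \<and> x \<in> {c..d} \<and> d - c < e \<and> P c d" if x: "x \<in> E k" and "e > 0" for x e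
    proof -
      obtain \<rho> where \<rho>: "\<rho> > 0" "ball x \<rho> \<subseteq> \<gamma> x"
        using \<gamma>(1) unfolding gauge_def by (meson open_contains_ball)
      \<comment> \<open>The interval has to fit into the gauge neighbourhood of \<open>x\<close> and
        into [a, b], where the integral can be split.\<close>
      let ?e = "min e (min \<rho> (min (x - a) (b - x)))"
      have "?e > 0" using \<rho> \<open>e > 0\<close> x by (auto simp: E_def)
      obtain c d where cd: "c < d" "x \<in> {c..d}" "d - c < ?e"
        "k \<le> \<bar>(integral {a..d} f - integral {a..c} f) / (d - c) - f x\<bar>"
        by (rule frequently_slope_imp_interval[of "\<lambda>r. k \<le> \<bar>r - f x\<bar>" "\<lambda>t. integral {a..t} f" x ?e])
          (use x \<open>?e > 0\<close> in \<open>auto simp: E_def s_def\<close>)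
      have "integral {a..c} f + integral {c..d} f = integral {a..d} f"
        by (rule Henstock_Kurzweil_Integration.integral_combine)
          (use cd in \<open>auto intro: integrable_subinterval_real[OF int]\<close>)
      then have "integral {c..d} f = integral {a..d} f - integral {a..c} f" by linarith
      then have "k \<le> \<bar>integral {c..d} f / (d - c) - f x\<bar>" using cd(4) by (simp only:)
      also have "\<dots> = \<bar>integral {c..d} f - (d - c) * f x\<bar> / (d - c)"
      proof -
        have "integral {c..d} f / (d - c) - f x = (integral {c..d} f - (d - c) * f x) / (d - c)"
          using cd(1) by (simp add: diff_divide_distrib)
        then show ?thesis using cd(1) by simp
      qed
      finally have "k * (d - c) \<le> \<bar>(d - c) * f x - integral {c..d} f\<bar>"
        using cd(1) by (simp add: pos_le_divide_eq abs_minus_commute)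
      moreover have "{c..d} \<subseteq> ball x \<rho>" using cd by (auto simp: dist_real_def)
      ultimately have "P c d" unfolding P_def using cd(2) \<rho>(2) by (intro bexI[of _ x]) auto
      then show ?thesis using cd by (intro exI[of _ c] exI[of _ d]) auto
    qed
    obtain F where F: "finite F" "\<And>c d. (c, d) \<in> F \<Longrightarrow> c < d \<and> {c..d} \<subseteq> {a<..<b} \<and> P c d"
      "disjoint_family_on (\<lambda>(c, d). {c..d}) F"
      and \<sigma>F: "\<And>M. M \<in> lmeasurable \<Longrightarrow> E k \<inter> (\<Union>(c, d)\<in>F. {c<..<d}) \<subseteq> M \<Longrightarrow> \<sigma> - \<sigma> / 2 \<le> measure lebesgue M"
      by (rule finite_Vitali_intervals[OF _ _ Eab \<sigma>(2), where P = P and e = "\<sigma> / 2"])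
        (use \<sigma>(1) cover in auto)
    have le: "\<And>c d. (c, d) \<in> F \<Longrightarrow> c \<le> d" using F(2) by (meson less_imp_le)
    define l where "l = (\<Sum>(c, d)\<in>F. d - c)"
    have "\<sigma> - \<sigma> / 2 \<le> measure lebesgue (\<Union>(c, d)\<in>F. {c<..<d})"
      by (rule \<sigma>F) (use F(1) in \<open>auto intro!: fmeasurable.finite_UN\<close>)
    also have "\<dots> = l"
      unfolding l_def by (rule measure_finite_disjoint_intervals[OF F(1) le F(3)])
    finally have l: "\<sigma> / 2 \<le> l" by simp
    have "\<exists>x. \<forall>p\<in>F. x p \<in> {fst p..snd p} \<and> {fst p..snd p} \<subseteq> \<gamma> (x p) \<and>
      k * (snd p - fst p) \<le> \<bar>(snd p - fst p) * f (x p) - integral {fst p..snd p} f\<bar>"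
    proof (rule bchoice, rule ballI)
      fix p assume "p \<in> F"
      then have "P (fst p) (snd p)" using F(2)[of "fst p" "snd p"] by simp
      then show "\<exists>y. y \<in> {fst p..snd p} \<and> {fst p..snd p} \<subseteq> \<gamma> y \<and>
        k * (snd p - fst p) \<le> \<bar>(snd p - fst p) * f y - integral {fst p..snd p} f\<bar>"
        unfolding P_def by blast
    qed
    then obtain x where x: "\<And>p. p \<in> F \<Longrightarrow> x p \<in> {fst p..snd p}" "\<And>p. p \<in> F \<Longrightarrow> {fst p..snd p} \<subseteq> \<gamma> (x p)"
      "\<And>p. p \<in> F \<Longrightarrow> k * (snd p - fst p) \<le> \<bar>(snd p - fst p) * f (x p) - integral {fst p..snd p} f\<bar>"
      by metis
    let ?t = "\<lambda>p. (x p, {fst p..snd p})"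
    have inj: "inj_on ?t F"
    proof (rule inj_onI)
      fix p q assume "p \<in> F" "q \<in> F" "?t p = ?t q"
      then show "p = q" using le[of "fst p" "snd p"] le[of "fst q" "snd q"]
        by (auto simp: prod_eq_iff Icc_eq_Icc)
    qed
    have "?t ` F tagged_partial_division_of cbox a b"
      unfolding tagged_partial_division_of_def
    proof (intro conjI allI impI; (elim conjE)?)
      show "finite (?t ` F)" using F(1) by simp
      show "y \<in> K" if "(y, K) \<in> ?t ` F" for y K using that x(1) by auto
      show "K \<subseteq> cbox a b" if yK: "(y, K) \<in> ?t ` F" for y K
      proof -
        obtain p where "p \<in> F" "(y, K) = ?t p" using yK by (elim imageE)
        then have "p \<in> F" "K = {fst p..snd p}" by simp_all
        moreover have "{fst p..snd p} \<subseteq> {a<..<b}" using F(2)[of "fst p" "snd p"] \<open>p \<in> F\<close> by simp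
        ultimately show ?thesis by (auto simp: subset_iff)
      qed
      show "\<exists>c d. K = cbox c d" if "(y, K) \<in> ?t ` F" for y K using that by (auto simp: box_real)
      show "interior K \<inter> interior K' = {}"
        if yK: "(y, K) \<in> ?t ` F" "(y', K') \<in> ?t ` F" "(y, K) \<noteq> (y', K')" for y K y' K'
      proof -
        obtain p q where "p \<in> F" "(y, K) = ?t p" "q \<in> F" "(y', K') = ?t q"
          using yK(1,2) by (elim imageE)
        moreover from this yK(3) have "p \<noteq> q" by auto
        ultimately have "K \<inter> K' = {}"
          using disjoint_family_onD[OF F(3), of p q] by (simp add: split_beta)
        then show ?thesis using interior_subset by blast
      qed
    qed
    moreover have "\<gamma> fine ?t ` F" unfolding fine_def using x(2) by blast
    ultimately have "(\<Sum>(x, K)\<in>?t ` F. norm (measure lborel K *\<^sub>R f x - integral K f)) < k * (\<sigma> / 2)"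
      by (rule \<gamma>(2))
    moreover have "(\<Sum>(x, K)\<in>?t ` F. norm (measure lborel K *\<^sub>R f x - integral K f)) =
      (\<Sum>p\<in>F. \<bar>(snd p - fst p) * f (x p) - integral {fst p..snd p} f\<bar>)"
      unfolding sum.reindex[OF inj] by (rule sum.cong) (use le in \<open>auto simp: content_real\<close>)
    moreover have "k * l \<le> (\<Sum>p\<in>F. \<bar>(snd p - fst p) * f (x p) - integral {fst p..snd p} f\<bar>)"
      unfolding l_def sum_distrib_left by (rule sum_mono) (use x(3) in \<open>auto simp: split_beta\<close>)
    moreover have "k * (\<sigma> / 2) \<le> k * l" using l \<open>k > 0\<close> by (intro mult_left_mono) auto
    ultimately show False by linarith
  qed
  have "{t \<in> {a<..<b}. \<not> (s t \<longlongrightarrow> f t) (at 0)} \<subseteq> (\<Union>n. E (1 / real (Suc n)))"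
  proof
    fix t assume t: "t \<in> {t \<in> {a<..<b}. \<not> (s t \<longlongrightarrow> f t) (at 0)}"
    then obtain e where e: "e > 0" "\<exists>\<^sub>F h in at 0. e \<le> \<bar>s t h - f t\<bar>"
      by (auto simp: tendsto_iff not_eventually dist_real_def not_less)
    obtain n where "1 / real (Suc n) < e" using e(1) nat_approx_posE by blast
    then have "\<exists>\<^sub>F h in at 0. 1 / real (Suc n) \<le> \<bar>s t h - f t\<bar>"
      using frequently_elim1[OF e(2)] by (meson less_imp_le order_trans)
    then show "t \<in> (\<Union>n. E (1 / real (Suc n)))" using t by (auto simp: E_def)
  qed
  moreover have "negligible (\<Union>n. E (1 / real (Suc n)))"
    by (intro negligible_countable_Union) (auto intro: negE)
  ultimately show ?thesis unfolding s_def by (rule negligible_subset[rotated])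
qed

section \<open>Curves on the torus\<close>

text \<open>The two curves may live in different metric spaces; this lets the coordinates of a lift
  inherit absolute continuity from a curve on the torus.\<close>

lemma absolutely_continuous_curve_dominated:
  assumes "absolutely_continuous_curve a b \<zeta>" "a \<le> a'" "b' \<le> b"
    and le: "\<And>c d. a' \<le> c \<Longrightarrow> c \<le> d \<Longrightarrow> d \<le> b' \<Longrightarrow> dist (\<eta> c) (\<eta> d) \<le> dist (\<zeta> c) (\<zeta> d)"
  shows "absolutely_continuous_curve a' b' \<eta>"
  unfolding absolutely_continuous_curve_def
proof (intro allI impI)
  fix e :: real assume "e > 0"
  obtain \<delta> where \<delta>: "\<delta> > 0" "\<And>D. finite D \<Longrightarrow> (\<And>c d. (c, d) \<in> D \<Longrightarrow> a \<le> c \<and> c \<le> d \<and> d \<le> b) \<Longrightarrow>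
    disjoint_family_on (\<lambda>(c, d). {c<..<d}) D \<Longrightarrow> (\<Sum>(c, d)\<in>D. d - c) < \<delta> \<Longrightarrow>
    (\<Sum>(c, d)\<in>D. dist (\<zeta> c) (\<zeta> d)) < e"
    using absolutely_continuous_curveD[OF assms(1) \<open>e > 0\<close>] by metis
  show "\<exists>\<delta>>0. \<forall>D :: (real \<times> real) set.
      finite D \<and> (\<forall>(c, d)\<in>D. a' \<le> c \<and> c \<le> d \<and> d \<le> b') \<and>
      disjoint_family_on (\<lambda>(c, d). {c<..<d}) D \<and> (\<Sum>(c, d)\<in>D. d - c) < \<delta> \<longrightarrow>
      (\<Sum>(c, d)\<in>D. dist (\<eta> c) (\<eta> d)) < e"
  proof (intro exI[of _ \<delta>] conjI allI impI \<delta>(1), elim conjE)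
    fix D :: "(real \<times> real) set"
    assume D: "finite D" "\<forall>(c, d)\<in>D. a' \<le> c \<and> c \<le> d \<and> d \<le> b'"
      "disjoint_family_on (\<lambda>(c, d). {c<..<d}) D" "(\<Sum>(c, d)\<in>D. d - c) < \<delta>"
    have D': "a' \<le> c \<and> c \<le> d \<and> d \<le> b'" if "(c, d) \<in> D" for c d
      using bspec[OF D(2) that] by simp
    have "(\<Sum>(c, d)\<in>D. dist (\<eta> c) (\<eta> d)) \<le> (\<Sum>(c, d)\<in>D. dist (\<zeta> c) (\<zeta> d))"
    proof (rule sum_mono, clarify)
      fix c d assume "(c, d) \<in> D"
      then show "dist (\<eta> c) (\<eta> d) \<le> dist (\<zeta> c) (\<zeta> d)" using D'[of c d] by (intro le) auto
    qed
    also have "\<dots> < e"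
      by (rule \<delta>(2)[OF D(1) _ D(3,4)]) (use D' assms(2,3) in force)
    finally show "(\<Sum>(c, d)\<in>D. dist (\<eta> c) (\<eta> d)) < e" .
  qed
qed

lemma absolutely_continuous_curve_subinterval:
  assumes "absolutely_continuous_curve a b \<zeta>" "a \<le> a'" "b' \<le> b"
  shows "absolutely_continuous_curve a' b' \<zeta>"
  using assms by (rule absolutely_continuous_curve_dominated) simp

lemma absolutely_continuous_curve_uniform:
  assumes "absolutely_continuous_curve a b \<zeta>" "\<epsilon> > 0"
  obtains \<delta> where "\<delta> > 0"
    "\<And>c d. c \<in> {a..b} \<Longrightarrow> d \<in> {a..b} \<Longrightarrow> dist c d < \<delta> \<Longrightarrow> dist (\<zeta> c) (\<zeta> d) < \<epsilon>"
proof -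
  obtain \<delta> where \<delta>: "\<delta> > 0" "\<And>D. finite D \<Longrightarrow> (\<And>c d. (c, d) \<in> D \<Longrightarrow> a \<le> c \<and> c \<le> d \<and> d \<le> b) \<Longrightarrow>
    disjoint_family_on (\<lambda>(c, d). {c<..<d}) D \<Longrightarrow> (\<Sum>(c, d)\<in>D. d - c) < \<delta> \<Longrightarrow>
    (\<Sum>(c, d)\<in>D. dist (\<zeta> c) (\<zeta> d)) < \<epsilon>"
    using absolutely_continuous_curveD[OF assms] by metis
  have 1: "dist (\<zeta> c) (\<zeta> d) < \<epsilon>" if "a \<le> c" "c \<le> d" "d \<le> b" "d - c < \<delta>" for c d
    using \<delta>(2)[of "{(c, d)}"] that by (simp add: disjoint_family_on_def)
  show thesis
  proof (rule that[OF \<delta>(1)])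
    fix c d assume "c \<in> {a..b}" "d \<in> {a..b}" "dist c d < \<delta>"
    then show "dist (\<zeta> c) (\<zeta> d) < \<epsilon>"
      using 1[of c d] 1[of d c] by (cases "c \<le> d") (auto simp: dist_real_def dist_commute)
  qed
qed

lemma absolutely_continuous_curve_imp_continuous_on:
  assumes "absolutely_continuous_curve a b \<zeta>"
  shows "continuous_on {a..b} \<zeta>"
  unfolding continuous_on_iff
proof (intro ballI allI impI)
  fix x e :: real assume "x \<in> {a..b}" "0 < e"
  obtain \<delta> where "\<delta> > 0"
    "\<And>c d. c \<in> {a..b} \<Longrightarrow> d \<in> {a..b} \<Longrightarrow> dist c d < \<delta> \<Longrightarrow> dist (\<zeta> c) (\<zeta> d) < e"
    using absolutely_continuous_curve_uniform[OF assms \<open>0 < e\<close>] by metis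
  then show "\<exists>d>0. \<forall>x'\<in>{a..b}. dist x' x < d \<longrightarrow> dist (\<zeta> x') (\<zeta> x) < e"
    using \<open>x \<in> {a..b}\<close> by (intro exI[of _ \<delta>]) simp
qed

section \<open>Translations and distances on the torus\<close>

text \<open>A nearest lattice vector exists, and subtracting it gives a shortest displacement. This
  takes the place of a lift to the universal cover.\<close>

lemma torus_displacement:
  fixes x y :: "'n::finite torus"
  obtains e where "y = x \<oplus> e" "norm e = dist x y"
proof -
  have "\<exists>e. y = x \<oplus> e \<and> norm e = dist x y"
  proof transfer
    fix x y :: "real ^ 'n"
    obtain k where k: "k \<in> int_lattice" "infdist (x - y) int_lattice = norm (x - y - k)"
      by (rule infdist_int_lattice_attained)
    show "\<exists>e. y - (x + e) \<in> int_lattice \<and> norm e = infdist (x - y) int_lattice"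
    proof (intro exI[of _ "y - x + k"] conjI)
      show "y - (x + (y - x + k)) \<in> int_lattice" using int_lattice_uminus[OF k(1)] by simp
      have "y - x + k = - (x - y - k)" by simp
      then show "norm (y - x + k) = infdist (x - y) int_lattice"
        unfolding k(2) by (simp only: norm_minus_cancel)
    qed
  qed
  with that show thesis by blast
qed

lemma translate_translate: "x \<oplus> u \<oplus> w = x \<oplus> (u + w)"
  by transfer (simp add: int_lattice_zero algebra_simps)

lemma translate_zero [simp]: "x \<oplus> 0 = x"
  by transfer (simp add: int_lattice_zero)

lemma dist_translate_le: "dist (x \<oplus> u) (y \<oplus> w) \<le> dist x y + norm (u - w)"
proof transfer
  fix x u y w :: "real ^ 'n"
  have "infdist (x + u - (y + w)) int_lattice = infdist ((x - y) + (u - w)) int_lattice"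
    by (simp add: algebra_simps)
  also have "\<dots> \<le> infdist (x - y) int_lattice + infdist (u - w) int_lattice"
    by (rule infdist_int_lattice_add)
  also have "infdist (u - w) int_lattice \<le> norm (u - w)"
    using infdist_int_lattice_le[OF int_lattice_zero, of "u - w"] by simp
  finally show "infdist (x + u - (y + w)) int_lattice \<le> infdist (x - y) int_lattice + norm (u - w)"
    by simp
qed

lemma int_lattice_norm_ge_1:
  fixes k :: "real ^ 'n"
  assumes "k \<in> int_lattice" "k \<noteq> 0"
  shows "1 \<le> norm k"
proof -
  obtain i where "k $ i \<noteq> 0" using assms(2) by (auto simp: vec_eq_iff)
  moreover have "k $ i \<in> \<int>" using assms(1) by (simp add: int_lattice_def)
  ultimately have "1 \<le> \<bar>k $ i\<bar>" by (rule Ints_nonzero_abs_ge1[rotated])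
  also have "\<dots> \<le> norm k" by (rule component_le_norm_cart)
  finally show ?thesis .
qed

text \<open>Nonzero lattice vectors have norm at least 1, so a vector of norm at most 1/2 is a
  shortest representative of its class.\<close>

lemma dist_translate_eq:
  assumes "norm (u - w) \<le> 1 / 2"
  shows "dist (x \<oplus> u) (x \<oplus> w) = norm (u - w)"
  using assms
proof transfer
  fix x u w :: "real ^ 'n" assume le: "norm (u - w) \<le> 1 / 2"
  obtain k where k: "k \<in> int_lattice" "infdist (u - w) int_lattice = norm (u - w - k)"
    by (rule infdist_int_lattice_attained)
  have "norm (u - w) \<le> norm (u - w - k)"
  proof (cases "k = 0")
    case False
    then have "1 \<le> norm k" using k(1) int_lattice_norm_ge_1 by blast
    also have "norm k \<le> norm (u - w) + norm (u - w - k)"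
      using norm_triangle_ineq4[of "u - w" "u - w - k"] by simp
    finally show ?thesis using le by linarith
  qed simp
  moreover have "infdist (u - w) int_lattice \<le> norm (u - w)"
    using infdist_int_lattice_le[OF int_lattice_zero, of "u - w"] by simp
  ultimately show "infdist (x + u - (x + w)) int_lattice = norm (u - w)"
    using k(2) by simp
qed

lemma tendsto_translate [tendsto_intros]:
  assumes "(f \<longlongrightarrow> x) F" "(g \<longlongrightarrow> u) F"
  shows "((\<lambda>s. f s \<oplus> g s) \<longlongrightarrow> x \<oplus> u) F"
proof -
  have "((\<lambda>s. dist (f s \<oplus> g s) (x \<oplus> u)) \<longlongrightarrow> 0) F"
  proof (rule tendsto_sandwich[OF _ _ tendsto_const])
    show "eventually (\<lambda>s. dist (f s \<oplus> g s) (x \<oplus> u) \<le> dist (f s) x + norm (g s - u)) F"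
      by (intro always_eventually allI dist_translate_le)
    have "((\<lambda>s. dist (f s) x + norm (g s - u)) \<longlongrightarrow> 0 + 0) F"
      using assms by (intro tendsto_add) (simp_all add: tendsto_dist_iff[of f] tendsto_norm_zero_iff LIM_zero)
    then show "((\<lambda>s. dist (f s) x + norm (g s - u)) \<longlongrightarrow> 0) F" by simp
  qed auto
  then show ?thesis using tendsto_dist_iff by blast
qed

lemma continuous_on_translate [continuous_intros]:
  "continuous_on S f \<Longrightarrow> continuous_on S g \<Longrightarrow> continuous_on S (\<lambda>s. f s \<oplus> g s)"
  unfolding continuous_on_def by (auto intro: tendsto_translate)

text \<open>Translating a fixed point \<open>z\<close> by the vectors of the unit cube reaches every
  point, by taking fractional parts of coordinates.\<close>

lemma compact_torus: "compact (UNIV :: 'n::finite torus set)"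
proof -
  fix z :: "'n torus"
  have "\<exists>u\<in>cbox 0 1. y = z \<oplus> u" for y
  proof transfer
    fix y z :: "real ^ 'n"
    show "\<exists>u\<in>cbox 0 1. y - (z + u) \<in> int_lattice"
    proof (rule bexI[of _ "\<chi> i. frac ((y - z) $ i)"])
      show "y - (z + (\<chi> i. frac ((y - z) $ i))) \<in> int_lattice"
        by (simp add: int_lattice_def frac_def)
      show "(\<chi> i. frac ((y - z) $ i)) \<in> cbox 0 1"
        by (simp add: mem_box_cart less_imp_le[OF frac_lt_1])
    qed
  qed
  then have "UNIV = (\<lambda>u. z \<oplus> u) ` cbox 0 1" by blast
  moreover have "compact ((\<lambda>u. z \<oplus> u) ` cbox 0 1)"
    by (intro compact_continuous_image continuous_intros compact_cbox)
  ultimately show ?thesis by simp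
qed

section \<open>Velocities of curves on the torus\<close>

text \<open>For small \<open>h\<close> the translates of the base point by h q and h q' are exactly
  |h| |q - q'| apart, while both are o(h) away from the curve. This justifies the definite
  description in \<open>velocity\<close>.\<close>

lemma has_velocity_unique:
  assumes "has_velocity \<zeta> q t" "has_velocity \<zeta> q' t"
  shows "q = q'"
proof -
  let ?d = "\<lambda>q h. dist (\<zeta> (t + h)) (\<zeta> t \<oplus> h *\<^sub>R q) / \<bar>h\<bar>"
  have "((\<lambda>h. ?d q h + ?d q' h) \<longlongrightarrow> 0 + 0) (at 0)"
    using assms unfolding has_velocity_def by (rule tendsto_add)
  moreover have "((\<lambda>h. norm (h *\<^sub>R (q - q'))) \<longlongrightarrow> norm (0 *\<^sub>R (q - q'))) (at 0)"
    by (intro tendsto_intros)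
  then have "eventually (\<lambda>h. norm (h *\<^sub>R (q - q')) < 1 / 2) (at 0)"
    by (rule order_tendstoD(2)) simp
  then have "eventually (\<lambda>h. norm (q - q') \<le> ?d q h + ?d q' h) (at 0)"
    using eventually_neq_at_within[of 0 "0::real" UNIV]
  proof eventually_elim
    case (elim h)
    have "\<bar>h\<bar> * norm (q - q') = norm (h *\<^sub>R q - h *\<^sub>R q')" by (simp flip: scaleR_diff_right)
    also have "\<dots> = dist (\<zeta> t \<oplus> h *\<^sub>R q) (\<zeta> t \<oplus> h *\<^sub>R q')"
      by (rule dist_translate_eq[symmetric]) (use elim(1) in \<open>simp flip: scaleR_diff_right\<close>)
    also have "\<dots> \<le> dist (\<zeta> (t + h)) (\<zeta> t \<oplus> h *\<^sub>R q) + dist (\<zeta> (t + h)) (\<zeta> t \<oplus> h *\<^sub>R q')"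
      by (rule dist_triangle3)
    finally have "norm (q - q') \<le> (dist (\<zeta> (t + h)) (\<zeta> t \<oplus> h *\<^sub>R q) + dist (\<zeta> (t + h)) (\<zeta> t \<oplus> h *\<^sub>R q')) / \<bar>h\<bar>"
      using elim(2) by (simp add: pos_le_divide_eq mult.commute)
    then show ?case by (simp add: add_divide_distrib)
  qed
  ultimately have "norm (q - q') \<le> 0 + 0"
    by (intro tendsto_lowerbound) auto
  then show ?thesis by simp
qed

lemma velocity_eqI: "has_velocity \<zeta> q t \<Longrightarrow> velocity \<zeta> t = q"
  unfolding velocity_def using has_velocity_unique by blast

lemma has_velocity_cong:
  assumes "eventually (\<lambda>s. \<zeta> s = \<eta> s) (nhds t)"
  shows "has_velocity \<zeta> q t \<longleftrightarrow> has_velocity \<eta> q t"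
proof -
  have t: "\<zeta> t = \<eta> t" using assms by (rule eventually_nhds_x_imp_x)
  have "eventually (\<lambda>s. \<zeta> s = \<eta> s) (at t)" using assms by (simp add: eventually_at_filter eventually_mono)
  then have "eventually (\<lambda>h. \<zeta> (t + h) = \<eta> (t + h)) (at 0)"
    by (simp add: at_to_0[of t] eventually_filtermap add.commute)
  then show ?thesis
    unfolding has_velocity_def t by (intro tendsto_cong) (auto elim: eventually_mono)
qed

lemma velocity_cong:
  "eventually (\<lambda>s. \<zeta> s = \<eta> s) (nhds t) \<Longrightarrow> velocity \<zeta> t = velocity \<eta> t"
  unfolding velocity_def by (simp add: has_velocity_cong)

text \<open>The torus distance never exceeds the norm of the difference of displacements, so
  derivatives of a local lift \<open>u\<close> pass down to the torus.\<close>

lemma has_velocity_translate: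
  assumes "eventually (\<lambda>s. \<zeta> s = x \<oplus> u s) (nhds t)" "((\<lambda>h. (u (t + h) - u t) /\<^sub>R h) \<longlongrightarrow> q) (at 0)"
  shows "has_velocity \<zeta> q t"
proof -
  have "((\<lambda>h. dist (x \<oplus> u (t + h)) (x \<oplus> u t \<oplus> h *\<^sub>R q) / \<bar>h\<bar>) \<longlongrightarrow> 0) (at 0)"
  proof (rule tendsto_sandwich[OF _ _ tendsto_const])
    show "((\<lambda>h. norm ((u (t + h) - u t) /\<^sub>R h - q)) \<longlongrightarrow> 0) (at 0)"
      using assms(2) by (simp add: tendsto_norm_zero_iff LIM_zero)
    show "eventually (\<lambda>h. dist (x \<oplus> u (t + h)) (x \<oplus> u t \<oplus> h *\<^sub>R q) / \<bar>h\<bar> \<le> norm ((u (t + h) - u t) /\<^sub>R h - q)) (at 0)"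
      using eventually_neq_at_within[of 0 "0::real" UNIV]
    proof eventually_elim
      case (elim h)
      have "dist (x \<oplus> u (t + h)) (x \<oplus> u t \<oplus> h *\<^sub>R q) \<le> norm (u (t + h) - (u t + h *\<^sub>R q))"
        using dist_translate_le[of x "u (t + h)" x "u t + h *\<^sub>R q"] by (simp add: translate_translate)
      also have "u (t + h) - (u t + h *\<^sub>R q) = h *\<^sub>R ((u (t + h) - u t) /\<^sub>R h - q)"
        using elim by (simp add: scaleR_diff_right)
      finally show ?case using elim by (simp add: pos_divide_le_eq mult.commute)
    qed
  qed auto
  then show ?thesis unfolding has_velocity_cong[OF assms(1)] by (simp add: has_velocity_def)
qed

lemma has_velocity_line: "has_velocity (\<lambda>s. x \<oplus> (s - a) *\<^sub>R q) q t"
proof (rule has_velocity_translate[where x = x and u = "\<lambda>s. (s - a) *\<^sub>R q"])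
  have "eventually (\<lambda>h. ((t + h - a) *\<^sub>R q - (t - a) *\<^sub>R q) /\<^sub>R h = q) (at 0)"
    using eventually_neq_at_within[of 0 "0::real" UNIV]
    by eventually_elim (simp flip: scaleR_diff_left)
  then show "((\<lambda>h. ((t + h - a) *\<^sub>R q - (t - a) *\<^sub>R q) /\<^sub>R h) \<longlongrightarrow> q) (at 0)"
    by (rule tendsto_eventually)
qed auto

lemma absolutely_continuous_curve_line:
  "absolutely_continuous_curve a b (\<lambda>s. x \<oplus> (s - c) *\<^sub>R q)"
  unfolding absolutely_continuous_curve_def
proof (intro allI impI)
  fix e :: real assume "e > 0"
  show "\<exists>\<delta>>0. \<forall>D :: (real \<times> real) set.
      finite D \<and> (\<forall>(c, d)\<in>D. a \<le> c \<and> c \<le> d \<and> d \<le> b) \<and>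
      disjoint_family_on (\<lambda>(c, d). {c<..<d}) D \<and> (\<Sum>(c, d)\<in>D. d - c) < \<delta> \<longrightarrow>
      (\<Sum>(c', d)\<in>D. dist (x \<oplus> (c' - c) *\<^sub>R q) (x \<oplus> (d - c) *\<^sub>R q)) < e"
  \<comment> \<open>The curve is Lipschitz with constant \<open>norm q\<close>; adding 1 avoids
    division by zero for q = 0.\<close>
  proof (intro exI[of _ "e / (norm q + 1)"] conjI allI impI, goal_cases)
    case 1 show ?case using \<open>e > 0\<close> by (simp add: divide_pos_pos add_nonneg_pos)
  next
    case (2 D)
    have "(\<Sum>(c', d)\<in>D. dist (x \<oplus> (c' - c) *\<^sub>R q) (x \<oplus> (d - c) *\<^sub>R q)) \<le> (\<Sum>(c, d)\<in>D. norm q * (d - c))"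
    proof (rule sum_mono, clarify)
      fix c' d assume "(c', d) \<in> D"
      then have "c' \<le> d" using 2 by auto
      have "dist (x \<oplus> (c' - c) *\<^sub>R q) (x \<oplus> (d - c) *\<^sub>R q) \<le> norm ((c' - c) *\<^sub>R q - (d - c) *\<^sub>R q)"
        using dist_translate_le[of x _ x] by simp
      also have "\<dots> = norm q * (d - c')" using \<open>c' \<le> d\<close> by (simp flip: scaleR_diff_left)
      finally show "dist (x \<oplus> (c' - c) *\<^sub>R q) (x \<oplus> (d - c) *\<^sub>R q) \<le> norm q * (d - c')" .
    qed
    also have "\<dots> = norm q * (\<Sum>(c, d)\<in>D. d - c)" by (simp add: sum_distrib_left split_beta)
    also have "\<dots> \<le> (norm q + 1) * (\<Sum>(c, d)\<in>D. d - c)"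
      using 2 by (intro mult_right_mono sum_nonneg) auto
    also have "\<dots> < e"
      using 2 by (simp add: pos_less_divide_eq add_nonneg_pos mult.commute)
    finally show ?case .
  qed
qed

text \<open>On a small interval the curve stays in a ball of radius 1/8, where lifting to the universal
  cover is isometric; the lift is then differentiable almost everywhere componentwise.\<close>

lemma absolutely_continuous_curve_has_velocity_ae:
  fixes \<zeta> :: "real \<Rightarrow> 'n::finite torus"
  assumes ac: "absolutely_continuous_curve a b \<zeta>"
  shows "negligible {t \<in> {a<..<b}. \<not> (\<exists>q. has_velocity \<zeta> q t)}" (is "negligible ?N")
  unfolding locally_negligible_alt[of ?N]
proof
  fix t0 assume "t0 \<in> ?N"
  then have t0: "a < t0" "t0 < b" by auto
  obtain \<delta> where \<delta>: "\<delta> > 0"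
    "\<And>c d. c \<in> {a..b} \<Longrightarrow> d \<in> {a..b} \<Longrightarrow> dist c d < \<delta> \<Longrightarrow> dist (\<zeta> c) (\<zeta> d) < 1 / 8"
    using absolutely_continuous_curve_uniform[OF ac, of "1 / 8"] by auto
  define r where "r = min (\<delta> / 2) (min (t0 - a) (b - t0))"
  have r: "r > 0" "r < \<delta>" "a \<le> t0 - r" "t0 + r \<le> b"
    using \<delta>(1) t0 by (auto simp: r_def min_def)
  \<comment> \<open>The displacements are chosen separately for each time. Near \<open>t0\<close>
    they have norm below 1/8, so any two differ by less than 1/4, and \<open>iso\<close> makes this
    arbitrary choice an isometric lift.\<close>
  have "\<exists>u. \<forall>s. \<zeta> s = \<zeta> t0 \<oplus> u s \<and> norm (u s) = dist (\<zeta> t0) (\<zeta> s)"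
    by (rule choice) (metis torus_displacement)
  then obtain u where u: "\<And>s. \<zeta> s = \<zeta> t0 \<oplus> u s" "\<And>s. norm (u s) = dist (\<zeta> t0) (\<zeta> s)" by metis
  have near: "norm (u s) < 1 / 8" if "t0 - r \<le> s" "s \<le> t0 + r" for s
    unfolding u(2) by (rule \<delta>(2)) (use that r t0 in \<open>auto simp: dist_real_def\<close>)
  have iso: "dist (\<zeta> c) (\<zeta> d) = norm (u c - u d)"
    if "t0 - r \<le> c" "c \<le> d" "d \<le> t0 + r" for c d
  proof -
    have "norm (u c - u d) \<le> 1 / 2"
      using norm_triangle_ineq4[of "u c" "u d"] near[of c] near[of d] that by simp
    then have "dist (\<zeta> t0 \<oplus> u c) (\<zeta> t0 \<oplus> u d) = norm (u c - u d)" by (rule dist_translate_eq)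
    then show ?thesis by (simp flip: u(1))
  qed
  have aci: "absolutely_continuous_curve (t0 - r) (t0 + r) (\<lambda>s. u s $ i)" for i
  proof (rule absolutely_continuous_curve_dominated[OF ac r(3,4)])
    fix c d assume "t0 - r \<le> c" "c \<le> d" "d \<le> t0 + r"
    then show "dist (u c $ i) (u d $ i) \<le> dist (\<zeta> c) (\<zeta> d)"
      using iso component_le_norm_cart[of "u c - u d" i] by (simp add: dist_real_def)
  qed
  let ?B = "\<lambda>i. {t \<in> {t0 - r<..<t0 + r}. \<not> (\<exists>l. ((\<lambda>h. (u (t + h) $ i - u t $ i) / h) \<longlongrightarrow> l) (at 0))}"
  have "?N \<inter> ball t0 r \<subseteq> (\<Union>i. ?B i)"
  proof (rule subsetI, rule ccontr)
    fix t assume t: "t \<in> ?N \<inter> ball t0 r" and nt: "t \<notin> (\<Union>i. ?B i)"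
    have tr: "t \<in> {t0 - r<..<t0 + r}" using t by (auto simp: dist_real_def)
    then have "\<forall>i. \<exists>l. ((\<lambda>h. (u (t + h) $ i - u t $ i) / h) \<longlongrightarrow> l) (at 0)" using nt by blast
    then obtain l where l: "\<And>i. ((\<lambda>h. (u (t + h) $ i - u t $ i) / h) \<longlongrightarrow> l i) (at 0)" by metis
    have "((\<lambda>h. (u (t + h) - u t) /\<^sub>R h) \<longlongrightarrow> (\<chi> i. l i)) (at 0)"
      by (rule vec_tendstoI) (use l in \<open>simp add: divide_inverse mult.commute\<close>)
    then have "has_velocity \<zeta> (\<chi> i. l i) t"
      by (rule has_velocity_translate[OF always_eventually[OF allI[OF u(1)]]])
    then show False using t by blast
  qed
  moreover have "negligible (\<Union>i. ?B i)"
    by (rule negligible_countable_Union) (use absolutely_continuous_differentiable_ae[OF aci] in auto)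
  ultimately have "negligible (?N \<inter> ball t0 r)" by (rule negligible_subset[rotated])
  then show "\<exists>U. openin (top_of_set ?N) U \<and> t0 \<in> U \<and> negligible U"
    using \<open>t0 \<in> ?N\<close> r(1) by (intro exI[of _ "?N \<inter> ball t0 r"]) (auto intro: openin_open_Int)
qed

section \<open>The Lagrangian\<close>

text \<open>The first-order condition at a common maximizer \<open>p\<close> identifies the
  derivative of \<open>f\<close> with the inner product with \<open>q\<close> and also with
  \<open>q'\<close>.\<close>

lemma differentiable_maximizer_unique_slope:
  fixes f :: "'a::real_inner \<Rightarrow> real"
  assumes "f differentiable (at p)" "\<And>p'. p' \<bullet> q - f p' \<le> p \<bullet> q - f p" "\<And>p'. p' \<bullet> q' - f p' \<le> p \<bullet> q' - f p"
  shows "q = q'"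
proof -
  obtain D where D: "(f has_derivative D) (at p)" using assms(1) by (auto simp: differentiable_def)
  have eq: "D = (\<lambda>h. h \<bullet> w)" if max: "\<And>p'. p' \<bullet> w - f p' \<le> p \<bullet> w - f p" for w
  proof -
    have "((\<lambda>p'. p' \<bullet> w - f p') has_derivative (\<lambda>h. h \<bullet> w - D h)) (at p)"
      by (intro derivative_intros D)
    then have "(\<lambda>h. h \<bullet> w - D h) = (\<lambda>h. 0)"
      by (rule differential_zero_maxmin[OF UNIV_I open_UNIV]) (use max in simp)
    then show ?thesis by (metis (no_types, lifting) eq_iff_diff_eq_0 ext)
  qed
  have "(q - q') \<bullet> q = (q - q') \<bullet> q'" using eq[OF assms(2)] eq[OF assms(3)] by metis
  then have "(q - q') \<bullet> (q - q') = 0" by (simp add: inner_diff_right)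
  then show ?thesis by simp
qed

locale superlinear_hamiltonian =
  fixes H :: "'n::finite torus \<Rightarrow> real \<Rightarrow> real ^ 'n \<Rightarrow> real" and T :: real
  assumes T_pos: "T > 0"
    and continuous_H: "continuous_on (UNIV \<times> {0..T} \<times> UNIV) (\<lambda>(x, t, p). H x t p)"
    and superlinear: "\<And>M. eventually (\<lambda>p. \<forall>x. \<forall>t\<in>{0..T}. M \<le> H x t p / norm p) at_infinity"
begin

abbreviation L where "L \<equiv> Lagrangian H"

lemma compact_domain: "compact ((UNIV :: 'n torus set) \<times> {0..T} \<times> cball (0 :: real ^ 'n) R)"
  by (intro compact_Times compact_torus compact_Icc compact_cball)

lemma H_zero_bounded:
  obtains C where "\<And>x t. t \<in> {0..T} \<Longrightarrow> \<bar>H x t 0\<bar> \<le> C"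
proof -
  have "compact ((\<lambda>(x, t, p). H x t p) ` (UNIV \<times> {0..T} \<times> cball 0 0))"
    by (intro compact_continuous_image continuous_on_subset[OF continuous_H] compact_domain) auto
  then obtain C where "\<forall>y\<in>(\<lambda>(x, t, p). H x t p) ` (UNIV \<times> {0..T} \<times> cball 0 0). norm y \<le> C"
    using compact_imp_bounded bounded_iff by blast
  then show thesis by (intro that[of C]) force
qed

text \<open>Far out, superlinearity makes every \<open>p\<close> a worse competitor than 0. The
  radius depends only on \<open>M\<close>, so later arguments stay in one compact set on which
  \<open>H\<close> is uniformly continuous.\<close>

lemma maximizer:
  obtains R where "R > 0" "\<And>x t q. t \<in> {0..T} \<Longrightarrow> norm q \<le> M \<Longrightarrow>
    \<exists>p. norm p \<le> R \<and> L x t q = p \<bullet> q - H x t p \<and> (\<forall>p'. p' \<bullet> q - H x t p' \<le> p \<bullet> q - H x t p)"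
proof -
  obtain C where C: "\<And>x t. t \<in> {0..T} \<Longrightarrow> \<bar>H x t 0\<bar> \<le> C" using H_zero_bounded by blast
  \<comment> \<open>The slope \<open>M\<close> beats the linear term for \<open>norm q\<close> up to
    \<open>M\<close>; the extra slope \<bar>C\<bar> beats the value -H(x, t, 0) of the competitor 0
    once \<open>norm p\<close> is at least 1.\<close>
  obtain b where b: "\<And>p x t. b \<le> norm p \<Longrightarrow> t \<in> {0..T} \<Longrightarrow> M + \<bar>C\<bar> \<le> H x t p / norm p"
    using superlinear[of "M + \<bar>C\<bar>"] unfolding eventually_at_infinity by blast
  define R where "R = max b 1"
  have R: "R > 0" "R \<ge> 1" "R \<ge> b" by (auto simp: R_def)
  show thesis
  proof (rule that[OF R(1)])
    fix x :: "'n torus" and t :: real and q :: "real ^ 'n" assume t: "t \<in> {0..T}" and q: "norm q \<le> M"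
    let ?f = "\<lambda>p. p \<bullet> q - H x t p"
    have "continuous_on (cball 0 R) (\<lambda>p. (\<lambda>(x, t, p). H x t p) (x, t, p))"
      by (rule continuous_on_compose2[OF continuous_H]) (use t in \<open>auto intro!: continuous_intros\<close>)
    then have "continuous_on (cball 0 R) ?f" by (intro continuous_intros) simp_all
    then obtain p where p: "p \<in> cball 0 R" "\<And>p'. p' \<in> cball 0 R \<Longrightarrow> ?f p' \<le> ?f p"
      using continuous_attains_sup[of "cball 0 R" ?f] R(1) by auto
    have far: "?f p' \<le> ?f 0" if "norm p' > R" for p'
    proof -
      have "norm p' > 0" using that R by linarith
      have "(M + \<bar>C\<bar>) * norm p' \<le> H x t p'"
        using b[of p' t x] that R t \<open>norm p' > 0\<close> by (simp add: pos_le_divide_eq)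
      moreover have "p' \<bullet> q \<le> norm p' * M"
        using norm_cauchy_schwarz[of p' q] mult_left_mono[OF q norm_ge_zero[of p']] by linarith
      moreover have "\<bar>C\<bar> * 1 \<le> \<bar>C\<bar> * norm p'" using that R by (intro mult_left_mono) auto
      ultimately show ?thesis using C[OF t, of x] by (simp add: algebra_simps)
    qed
    have max: "?f p' \<le> ?f p" for p'
    proof (cases "norm p' > R")
      case True
      then show ?thesis using far p(2)[of 0] R(1) by (meson centre_in_cball less_imp_le order_trans)
    qed (use p(2) in auto)
    then have "L x t q = ?f p"
      unfolding Lagrangian_def by (intro cSup_eq_maximum) auto
    with max p(1) show "\<exists>p. norm p \<le> R \<and> L x t q = p \<bullet> q - H x t p \<and> (\<forall>p'. p' \<bullet> q - H x t p' \<le> p \<bullet> q - H x t p)"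
      by auto
  qed
qed

lemma Fenchel_inequality:
  assumes "t \<in> {0..T}"
  shows "p \<bullet> q - H x t p \<le> L x t q"
  using maximizer[of "norm q"] assms by (metis order_refl)

text \<open>A maximizer \<open>p\<close> for (x', t', q') is a competitor for (x, t, q), and it lies
  in a ball given by \<open>M\<close> alone. The one-sided estimate also gives the other side, since
  the assumptions are symmetric in the two triples.\<close>

lemma Lagrangian_uniformly_continuous:
  assumes "e > 0"
  obtains \<delta> where "\<delta> > 0"
    "\<And>x x' t t' q q'. t \<in> {0..T} \<Longrightarrow> t' \<in> {0..T} \<Longrightarrow> norm q \<le> M \<Longrightarrow> norm q' \<le> M \<Longrightarrow>
      dist x x' < \<delta> \<Longrightarrow> dist t t' < \<delta> \<Longrightarrow> dist q q' < \<delta> \<Longrightarrow> L x' t' q' \<le> L x t q + e"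
proof -
  obtain R where R: "R > 0" "\<And>x t q. t \<in> {0..T} \<Longrightarrow> norm q \<le> M \<Longrightarrow>
    \<exists>p. norm p \<le> R \<and> L x t q = p \<bullet> q - H x t p \<and> (\<forall>p'. p' \<bullet> q - H x t p' \<le> p \<bullet> q - H x t p)"
    using maximizer[of M] by metis
  have "uniformly_continuous_on (UNIV \<times> {0..T} \<times> cball 0 R) (\<lambda>(x, t, p). H x t p)"
    by (intro compact_uniformly_continuous continuous_on_subset[OF continuous_H] compact_domain) auto
  then obtain d where d: "d > 0" "\<And>z z'. z \<in> UNIV \<times> {0..T} \<times> cball 0 R \<Longrightarrow> z' \<in> UNIV \<times> {0..T} \<times> cball 0 R \<Longrightarrow>
    dist z' z < d \<Longrightarrow> dist ((\<lambda>(x, t, p). H x t p) z') ((\<lambda>(x, t, p). H x t p) z) < e / 2"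
    unfolding uniformly_continuous_on_def using half_gt_zero[OF assms] by metis
  \<comment> \<open>The first bound halves \<open>d\<close> between position and time; the second
    makes the change of the linear term at most e/2.\<close>
  define \<delta> where "\<delta> = min (d / 2) (e / (2 * R))"
  have \<delta>: "\<delta> > 0" "\<delta> \<le> d / 2" "\<delta> \<le> e / (2 * R)" using d(1) R(1) assms by (simp_all add: \<delta>_def)
  show thesis
  proof (rule that[OF \<delta>(1)])
    fix x x' :: "'n torus" and t t' :: real and q q' :: "real ^ 'n"
    assume t: "t \<in> {0..T}" "t' \<in> {0..T}" and q: "norm q \<le> M" "norm q' \<le> M"
      and close: "dist x x' < \<delta>" "dist t t' < \<delta>" "dist q q' < \<delta>"
    obtain p where p: "norm p \<le> R" "L x' t' q' = p \<bullet> q' - H x' t' p" using R(2)[OF t(2) q(2)] by blast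
    have "dist (x', t', p) (x, t, p) \<le> dist x' x + dist t' t"
      unfolding dist_Pair_Pair by (simp add: sqrt_sum_squares_le_sum)
    also have "\<dots> < d" using close(1,2) \<delta>(2) by (simp add: dist_commute)
    finally have "dist (H x' t' p) (H x t p) < e / 2"
      using d(2)[of "(x, t, p)" "(x', t', p)"] t p(1) by simp
    then have "H x t p \<le> H x' t' p + e / 2" unfolding dist_real_def by linarith
    moreover have "p \<bullet> q' - p \<bullet> q \<le> e / 2"
    proof -
      have "p \<bullet> q' - p \<bullet> q \<le> norm p * norm (q' - q)"
        using norm_cauchy_schwarz[of p "q' - q"] by (simp add: inner_diff_right)
      also have "\<dots> \<le> R * (e / (2 * R))"
        using p(1) close(3) \<delta>(3) R(1) by (intro mult_mono) (auto simp: dist_norm norm_minus_commute)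
      also have "\<dots> = e / 2" using R(1) by simp
      finally show ?thesis .
    qed
    ultimately show "L x' t' q' \<le> L x t q + e" using Fenchel_inequality[OF t(1), of p q x] p(2) by linarith
  qed
qed

lemma continuous_Lagrangian_line:
  assumes "0 \<le> a" "b \<le> T"
  shows "continuous_on {a..b} (\<lambda>s. L (y \<oplus> (s - c) *\<^sub>R q) s q)"
  unfolding continuous_on_iff
proof (intro ballI allI impI)
  fix s e :: real assume s: "s \<in> {a..b}" and "e > 0"
  obtain \<delta> where \<delta>: "\<delta> > 0"
    "\<And>x x' t t' w w'. t \<in> {0..T} \<Longrightarrow> t' \<in> {0..T} \<Longrightarrow> norm w \<le> norm q \<Longrightarrow> norm w' \<le> norm q \<Longrightarrow>
      dist x x' < \<delta> \<Longrightarrow> dist t t' < \<delta> \<Longrightarrow> dist w w' < \<delta> \<Longrightarrow> L x' t' w' \<le> L x t w + e / 2"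
    using Lagrangian_uniformly_continuous[of "e / 2" "norm q"] \<open>e > 0\<close> by (metis half_gt_zero)
  \<comment> \<open>During a time \<open>d\<close> the segment moves by less than \<delta>, and
    \<open>d\<close> itself is at most \<delta>.\<close>
  define d where "d = \<delta> / (norm q + 1)"
  have "norm q + 1 > 0" by (simp add: add_nonneg_pos)
  then have d: "d > 0" "d \<le> \<delta>" "d * norm q < \<delta>"
  proof -
    show "d > 0" using \<delta>(1) \<open>norm q + 1 > 0\<close> by (simp add: d_def)
    have "d * (norm q + 1) = \<delta>" using \<open>norm q + 1 > 0\<close> by (simp add: d_def)
    then have *: "d * norm q + d = \<delta>" by (simp add: distrib_left)
    show "d * norm q < \<delta>" using * \<open>d > 0\<close> by linarith
    have "d * norm q \<ge> 0" using \<open>d > 0\<close> by simp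
    then show "d \<le> \<delta>" using * by linarith
  qed
  show "\<exists>d>0. \<forall>s'\<in>{a..b}. dist s' s < d \<longrightarrow>
    dist (L (y \<oplus> (s' - c) *\<^sub>R q) s' q) (L (y \<oplus> (s - c) *\<^sub>R q) s q) < e"
  proof (intro exI[of _ d] conjI ballI impI d(1))
    fix s' assume s': "s' \<in> {a..b}" "dist s' s < d"
    have "dist (y \<oplus> (s' - c) *\<^sub>R q) (y \<oplus> (s - c) *\<^sub>R q) \<le> norm ((s' - c) *\<^sub>R q - (s - c) *\<^sub>R q)"
      using dist_translate_le[of y _ y] by simp
    also have "\<dots> = dist s' s * norm q" by (simp add: dist_real_def flip: scaleR_diff_left)
    also have "\<dots> \<le> d * norm q" using s'(2) by (intro mult_right_mono) auto
    finally have *: "dist (y \<oplus> (s' - c) *\<^sub>R q) (y \<oplus> (s - c) *\<^sub>R q) < \<delta>" using d(3) by linarith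
    have t: "s \<in> {0..T}" "s' \<in> {0..T}" using s s' assms by auto
    have "dist s' s < \<delta>" using s'(2) d(2) by linarith
    then have "L (y \<oplus> (s' - c) *\<^sub>R q) s' q \<le> L (y \<oplus> (s - c) *\<^sub>R q) s q + e / 2"
      "L (y \<oplus> (s - c) *\<^sub>R q) s q \<le> L (y \<oplus> (s' - c) *\<^sub>R q) s' q + e / 2"
      using \<delta>(1) t * by (auto intro!: \<delta>(2) simp: dist_commute)
    then show "dist (L (y \<oplus> (s' - c) *\<^sub>R q) s' q) (L (y \<oplus> (s - c) *\<^sub>R q) s q) < e"
      using \<open>e > 0\<close> by (simp add: dist_real_def abs_if)
  qed
qed

end

section \<open>Concatenation of curves\<close>

text \<open>Clamping the time is monotone and does not increase lengths, so it maps a short disjoint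
  family in any interval to a short disjoint family in [a, b].\<close>

lemma absolutely_continuous_curve_clip:
  assumes ac: "absolutely_continuous_curve a b \<zeta>" and "a \<le> b"
  shows "absolutely_continuous_curve a' b' (\<lambda>s. \<zeta> (max a (min b s)))"
  unfolding absolutely_continuous_curve_def
proof (intro allI impI)
  fix e :: real assume "e > 0"
  obtain \<delta> where \<delta>: "\<delta> > 0" "\<And>D. finite D \<Longrightarrow> (\<And>c d. (c, d) \<in> D \<Longrightarrow> a \<le> c \<and> c \<le> d \<and> d \<le> b) \<Longrightarrow>
    disjoint_family_on (\<lambda>(c, d). {c<..<d}) D \<Longrightarrow> (\<Sum>(c, d)\<in>D. d - c) < \<delta> \<Longrightarrow>
    (\<Sum>(c, d)\<in>D. dist (\<zeta> c) (\<zeta> d)) < e"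
    using absolutely_continuous_curveD[OF ac \<open>e > 0\<close>] by metis
  define k where "k s = max a (min b s)" for s
  define m where "m = (\<lambda>p :: real \<times> real. (k (fst p), k (snd p)))"
  have k: "a \<le> k s" "k s \<le> b" for s using \<open>a \<le> b\<close> by (auto simp: k_def)
  have k_sub: "{k c<..<k d} \<subseteq> {c<..<d}" for c d by (auto simp: k_def)
  have k_diff: "c \<le> d \<Longrightarrow> 0 \<le> k d - k c" "c \<le> d \<Longrightarrow> k d - k c \<le> d - c" for c d by (auto simp: k_def)
  show "\<exists>\<delta>>0. \<forall>D :: (real \<times> real) set.
      finite D \<and> (\<forall>(c, d)\<in>D. a' \<le> c \<and> c \<le> d \<and> d \<le> b') \<and>
      disjoint_family_on (\<lambda>(c, d). {c<..<d}) D \<and> (\<Sum>(c, d)\<in>D. d - c) < \<delta> \<longrightarrow>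
      (\<Sum>(c, d)\<in>D. dist (\<zeta> (max a (min b c))) (\<zeta> (max a (min b d)))) < e"
    unfolding k_def[symmetric]
  proof (intro exI[of _ \<delta>] conjI allI impI \<delta>(1), elim conjE)
    fix D :: "(real \<times> real) set"
    assume D: "finite D" "\<forall>(c, d)\<in>D. a' \<le> c \<and> c \<le> d \<and> d \<le> b'"
      "disjoint_family_on (\<lambda>(c, d). {c<..<d}) D" "(\<Sum>(c, d)\<in>D. d - c) < \<delta>"
    have le: "fst p \<le> snd p" if "p \<in> D" for p using bspec[OF D(2) that] by (simp add: split_beta)
    \<comment> \<open>Different intervals may collapse to the same degenerate pair. These contribute
      nothing, and without them the map \<open>m\<close> is injective, as reindexing the sum
      requires.\<close>
    define D0 where "D0 = {p \<in> D. k (fst p) < k (snd p)}"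
    have D0: "finite D0" "D0 \<subseteq> D" using D(1) by (auto simp: D0_def)
    have dis: "{fst (m p)<..<snd (m p)} \<inter> {fst (m q)<..<snd (m q)} = {}"
      if "p \<in> D0" "q \<in> D0" "p \<noteq> q" for p q
    proof -
      have "{fst p<..<snd p} \<inter> {fst q<..<snd q} = {}"
        using disjoint_family_onD[OF D(3), of p q] that subsetD[OF D0(2)] by (simp add: split_beta)
      moreover have "{fst (m p)<..<snd (m p)} \<inter> {fst (m q)<..<snd (m q)} \<subseteq> {fst p<..<snd p} \<inter> {fst q<..<snd q}"
        unfolding m_def fst_conv snd_conv by (intro Int_mono k_sub)
      ultimately show ?thesis by (simp only: subset_empty)
    qed
    have inj: "inj_on m D0"
    proof (rule inj_onI, rule ccontr)
      fix p q assume pq: "p \<in> D0" "q \<in> D0" "m p = m q" "p \<noteq> q"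
      have "fst (m p) < snd (m p)" using pq(1) by (simp add: D0_def m_def)
      then have "{fst (m p)<..<snd (m p)} \<noteq> {}" by simp
      then show False using dis[OF pq(1,2,4)] pq(3) by simp
    qed
    have "(\<Sum>(c, d)\<in>D. dist (\<zeta> (k c)) (\<zeta> (k d))) = (\<Sum>(c, d)\<in>D0. dist (\<zeta> (k c)) (\<zeta> (k d)))"
    proof (rule sum.mono_neutral_right[OF D(1) D0(2)], rule ballI)
      fix p assume p: "p \<in> D - D0"
      then have "k (fst p) = k (snd p)" using k_diff(1)[OF le, of p] by (auto simp: D0_def)
      then show "(case p of (c, d) \<Rightarrow> dist (\<zeta> (k c)) (\<zeta> (k d))) = 0" by (simp add: split_beta)
    qed
    also have "\<dots> = (\<Sum>(c, d)\<in>m ` D0. dist (\<zeta> c) (\<zeta> d))"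
      unfolding sum.reindex[OF inj] by (simp add: m_def split_beta)
    also have "\<dots> < e"
    proof (rule \<delta>(2))
      show "finite (m ` D0)" using D0(1) by simp
      show "a \<le> c \<and> c \<le> d \<and> d \<le> b" if "(c, d) \<in> m ` D0" for c d
        using that k by (auto simp: m_def D0_def less_imp_le)
      show "disjoint_family_on (\<lambda>(c, d). {c<..<d}) (m ` D0)"
        unfolding disjoint_family_on_def
      proof (intro ballI impI)
        fix p' q' assume "p' \<in> m ` D0" "q' \<in> m ` D0" "p' \<noteq> q'"
        then obtain p q where "p \<in> D0" "q \<in> D0" "p' = m p" "q' = m q" "p \<noteq> q" by blast
        then show "(case p' of (c, d) \<Rightarrow> {c<..<d}) \<inter> (case q' of (c, d) \<Rightarrow> {c<..<d}) = {}"
          using dis[of p q] by (simp add: split_beta)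
      qed
      have "(\<Sum>(c, d)\<in>m ` D0. d - c) = (\<Sum>p\<in>D0. k (snd p) - k (fst p))"
        unfolding sum.reindex[OF inj] by (simp add: m_def split_beta)
      also have "\<dots> \<le> (\<Sum>p\<in>D0. snd p - fst p)"
        by (rule sum_mono) (use le D0(2) in \<open>auto intro!: k_diff(2)\<close>)
      also have "\<dots> \<le> (\<Sum>p\<in>D. snd p - fst p)"
        by (rule sum_mono2[OF D(1) D0(2)]) (simp add: le)
      finally show "(\<Sum>(c, d)\<in>m ` D0. d - c) < \<delta>" using D(4) by (simp add: split_beta)
    qed
    finally show "(\<Sum>(c, d)\<in>D. dist (\<zeta> (k c)) (\<zeta> (k d))) < e" .
  qed
qed

lemma absolutely_continuous_curve_add_dominated:
  assumes "absolutely_continuous_curve a b \<zeta>" "absolutely_continuous_curve a b \<eta>"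
    and le: "\<And>c d. a \<le> c \<Longrightarrow> c \<le> d \<Longrightarrow> d \<le> b \<Longrightarrow> dist (\<xi> c) (\<xi> d) \<le> dist (\<zeta> c) (\<zeta> d) + dist (\<eta> c) (\<eta> d)"
  shows "absolutely_continuous_curve a b \<xi>"
  unfolding absolutely_continuous_curve_def
proof (intro allI impI)
  fix e :: real assume "e > 0"
  obtain \<delta> where \<delta>: "\<delta> > 0" "\<And>D. finite D \<Longrightarrow> (\<And>c d. (c, d) \<in> D \<Longrightarrow> a \<le> c \<and> c \<le> d \<and> d \<le> b) \<Longrightarrow>
    disjoint_family_on (\<lambda>(c, d). {c<..<d}) D \<Longrightarrow> (\<Sum>(c, d)\<in>D. d - c) < \<delta> \<Longrightarrow>
    (\<Sum>(c, d)\<in>D. dist (\<zeta> c) (\<zeta> d)) < e / 2"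
    using absolutely_continuous_curveD[OF assms(1) half_gt_zero[OF \<open>e > 0\<close>]] by metis
  obtain \<delta>' where \<delta>': "\<delta>' > 0" "\<And>D. finite D \<Longrightarrow> (\<And>c d. (c, d) \<in> D \<Longrightarrow> a \<le> c \<and> c \<le> d \<and> d \<le> b) \<Longrightarrow>
    disjoint_family_on (\<lambda>(c, d). {c<..<d}) D \<Longrightarrow> (\<Sum>(c, d)\<in>D. d - c) < \<delta>' \<Longrightarrow>
    (\<Sum>(c, d)\<in>D. dist (\<eta> c) (\<eta> d)) < e / 2"
    using absolutely_continuous_curveD[OF assms(2) half_gt_zero[OF \<open>e > 0\<close>]] by metis
  show "\<exists>\<delta>>0. \<forall>D :: (real \<times> real) set.
      finite D \<and> (\<forall>(c, d)\<in>D. a \<le> c \<and> c \<le> d \<and> d \<le> b) \<and>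
      disjoint_family_on (\<lambda>(c, d). {c<..<d}) D \<and> (\<Sum>(c, d)\<in>D. d - c) < \<delta> \<longrightarrow>
      (\<Sum>(c, d)\<in>D. dist (\<xi> c) (\<xi> d)) < e"
  proof (intro exI[of _ "min \<delta> \<delta>'"] conjI allI impI, goal_cases)
    case 1 show ?case using \<delta>(1) \<delta>'(1) by simp
  next
    case (2 D)
    have D: "finite D" "disjoint_family_on (\<lambda>(c, d). {c<..<d}) D" using 2 by blast+
    have D': "a \<le> c \<and> c \<le> d \<and> d \<le> b" if "(c, d) \<in> D" for c d using 2 that by blast
    have small: "(\<Sum>(c, d)\<in>D. d - c) < \<delta>" "(\<Sum>(c, d)\<in>D. d - c) < \<delta>'" using 2 by linarith+
    have "(\<Sum>(c, d)\<in>D. dist (\<xi> c) (\<xi> d)) \<le> (\<Sum>(c, d)\<in>D. dist (\<zeta> c) (\<zeta> d) + dist (\<eta> c) (\<eta> d))"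
    proof (rule sum_mono, clarify)
      fix c d assume "(c, d) \<in> D"
      then show "dist (\<xi> c) (\<xi> d) \<le> dist (\<zeta> c) (\<zeta> d) + dist (\<eta> c) (\<eta> d)" using D'[of c d] by (intro le) auto
    qed
    also have "\<dots> = (\<Sum>(c, d)\<in>D. dist (\<zeta> c) (\<zeta> d)) + (\<Sum>(c, d)\<in>D. dist (\<eta> c) (\<eta> d))"
      by (simp add: split_beta sum.distrib)
    also have "\<dots> < e" using \<delta>(2)[OF D(1) D' D(2) small(1)] \<delta>'(2)[OF D(1) D' D(2) small(2)] by linarith
    finally show ?case .
  qed
qed

text \<open>Every increment of the joined curve is bounded by the sum of the increments of the two
  clamped halves, so intervals that straddle \<open>b\<close> never have to be cut.\<close>

lemma absolutely_continuous_curve_join: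
  assumes "absolutely_continuous_curve a b \<zeta>" "absolutely_continuous_curve b c \<eta>" "a \<le> b" "b \<le> c" "\<zeta> b = \<eta> b"
  shows "absolutely_continuous_curve a c (\<lambda>s. if s \<le> b then \<zeta> s else \<eta> s)"
proof (rule absolutely_continuous_curve_add_dominated)
  show "absolutely_continuous_curve a c (\<lambda>s. \<zeta> (max a (min b s)))"
    by (rule absolutely_continuous_curve_clip[OF assms(1,3)])
  show "absolutely_continuous_curve a c (\<lambda>s. \<eta> (max b (min c s)))"
    by (rule absolutely_continuous_curve_clip[OF assms(2,4)])
  fix s r assume "a \<le> s" "s \<le> r" "r \<le> c"
  then show "dist (if s \<le> b then \<zeta> s else \<eta> s) (if r \<le> b then \<zeta> r else \<eta> r) \<le>
    dist (\<zeta> (max a (min b s))) (\<zeta> (max a (min b r))) + dist (\<eta> (max b (min c s))) (\<eta> (max b (min c r)))"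
    using assms(3-5) dist_triangle[of "\<zeta> s" "\<eta> r" "\<eta> b"]
    by (auto simp: max_def min_def)
qed

section \<open>Locality and additivity of the action\<close>

text \<open>This translates the Lebesgue action into a gauge integral, the setting of the rules for
  splitting and of the differentiation theorem above.\<close>

lemma action_eq_ereal_iff:
  "action L a b \<zeta> = ereal A \<longleftrightarrow> absolutely_continuous_curve a b \<zeta> \<and>
    (\<lambda>s. L (\<zeta> s) s (velocity \<zeta> s)) absolutely_integrable_on {a..b} \<and>
    A = integral {a..b} (\<lambda>s. L (\<zeta> s) s (velocity \<zeta> s))"
  unfolding action_def by (auto simp: set_lebesgue_integral_eq_integral(2))

lemma action_finite_or_infinite: "(\<exists>A. action L a b \<zeta> = ereal A) \<or> action L a b \<zeta> = \<infinity>"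
  by (simp add: action_def)

text \<open>The velocity is two-sided, so at \<open>a\<close> and \<open>b\<close> it also depends
  on the curve outside the interval; the velocities may differ there, but two points are
  negligible.\<close>

lemma action_cong:
  assumes "action L a b \<zeta> = ereal A" "\<And>s. a \<le> s \<Longrightarrow> s \<le> b \<Longrightarrow> \<eta> s = \<zeta> s"
  shows "action L a b \<eta> = ereal A"
proof -
  let ?f = "\<lambda>\<zeta> s. L (\<zeta> s) s (velocity \<zeta> s)"
  have A: "absolutely_continuous_curve a b \<zeta>" "?f \<zeta> absolutely_integrable_on {a..b}" "A = integral {a..b} (?f \<zeta>)"
    using assms(1) by (simp_all add: action_eq_ereal_iff)
  have eq: "?f \<eta> s = ?f \<zeta> s" if "s \<in> {a..b} - {a, b}" for s
  proof -
    have "eventually (\<lambda>r. r \<in> {a<..<b}) (nhds s)"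
      by (rule eventually_nhds_in_open) (use that in auto)
    then have "velocity \<eta> s = velocity \<zeta> s"
      by (intro velocity_cong) (auto elim!: eventually_mono intro: assms(2))
    then show ?thesis using assms(2)[of s] that by simp
  qed
  have neg: "negligible {a, b}" by simp
  have "absolutely_continuous_curve a b \<eta>"
    by (rule absolutely_continuous_curve_dominated[OF A(1) order_refl order_refl]) (simp add: assms(2))
  moreover have "?f \<eta> absolutely_integrable_on {a..b}"
    by (rule absolutely_integrable_spike[OF A(2) neg eq])
  moreover have "integral {a..b} (?f \<zeta>) = integral {a..b} (?f \<eta>)"
    by (rule integral_spike[OF neg eq])
  ultimately show ?thesis using A(3) by (simp add: action_eq_ereal_iff)
qed

lemma action_split:
  assumes "action L a c \<zeta> = ereal A" "a \<le> b" "b \<le> c"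
  obtains A1 A2 where "action L a b \<zeta> = ereal A1" "action L b c \<zeta> = ereal A2" "A = A1 + A2"
proof -
  let ?f = "\<lambda>s. L (\<zeta> s) s (velocity \<zeta> s)"
  have A: "absolutely_continuous_curve a c \<zeta>" "?f absolutely_integrable_on {a..c}" "A = integral {a..c} ?f"
    using assms(1) by (simp_all add: action_eq_ereal_iff)
  show thesis
  proof (rule that)
    show "action L a b \<zeta> = ereal (integral {a..b} ?f)"
      unfolding action_eq_ereal_iff using assms(2,3)
      by (auto intro: absolutely_continuous_curve_subinterval[OF A(1)] set_integrable_subset[OF A(2)])
    show "action L b c \<zeta> = ereal (integral {b..c} ?f)"
      unfolding action_eq_ereal_iff using assms(2,3)
      by (auto intro: absolutely_continuous_curve_subinterval[OF A(1)] set_integrable_subset[OF A(2)])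
    show "A = integral {a..b} ?f + integral {b..c} ?f"
      unfolding A(3)
      by (rule Henstock_Kurzweil_Integration.integral_combine[symmetric, OF assms(2,3)])
        (rule set_lebesgue_integral_eq_integral(1)[OF A(2)])
  qed
qed

lemma action_join:
  assumes "action L a b \<zeta> = ereal A1" "action L b c \<eta> = ereal A2" "a \<le> b" "b \<le> c" "\<zeta> b = \<eta> b"
  shows "action L a c (\<lambda>s. if s \<le> b then \<zeta> s else \<eta> s) = ereal (A1 + A2)" (is "action L a c ?\<xi> = _")
proof -
  let ?f = "\<lambda>\<zeta> s. L (\<zeta> s) s (velocity \<zeta> s)"
  have 1: "action L a b ?\<xi> = ereal A1" by (rule action_cong[OF assms(1)]) simp
  have 2: "action L b c ?\<xi> = ereal A2" by (rule action_cong[OF assms(2)]) (use assms(5) in auto)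
  note A = 1[unfolded action_eq_ereal_iff] 2[unfolded action_eq_ereal_iff]
  have "absolutely_continuous_curve a c ?\<xi>"
    by (rule absolutely_continuous_curve_join) (use assms in \<open>simp_all add: action_eq_ereal_iff\<close>)
  moreover have "?f ?\<xi> absolutely_integrable_on {a..b} \<union> {b..c}"
    using A by (intro set_integrable_Un) auto
  then have int: "?f ?\<xi> absolutely_integrable_on {a..c}" using assms(3,4) by (simp add: ivl_disj_un_two_touch)
  moreover have "integral {a..b} (?f ?\<xi>) + integral {b..c} (?f ?\<xi>) = integral {a..c} (?f ?\<xi>)"
    by (rule Henstock_Kurzweil_Integration.integral_combine[OF assms(3,4)])
      (rule set_lebesgue_integral_eq_integral(1)[OF int])
  ultimately show ?thesis unfolding action_eq_ereal_iff using A by simp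
qed

section \<open>The value function\<close>

locale lax_oleinik_problem = superlinear_hamiltonian H T
  for H :: "'n::finite torus \<Rightarrow> real \<Rightarrow> real ^ 'n \<Rightarrow> real" and T :: real +
  fixes g :: "'n torus \<Rightarrow> real"
  assumes continuous_g: "continuous_on UNIV g"
begin

abbreviation v where "v \<equiv> lax_oleinik H T g"

abbreviation segment_cost where
  "segment_cost y a b q \<equiv> integral {a..b} (\<lambda>s. L (y \<oplus> (s - a) *\<^sub>R q) s q)"

lemma action_segment:
  assumes "0 \<le> a" "a \<le> b" "b \<le> T"
  shows "action L a b (\<lambda>s. y \<oplus> (s - a) *\<^sub>R q) = ereal (segment_cost y a b q)"
proof -
  have "velocity (\<lambda>s. y \<oplus> (s - a) *\<^sub>R q) s = q" for s
    by (rule velocity_eqI[OF has_velocity_line])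
  then show ?thesis
    unfolding action_eq_ereal_iff
    using absolutely_continuous_curve_line
      absolutely_integrable_continuous_real[OF continuous_Lagrangian_line[OF assms(1,3), of y a q]] by simp
qed

section \<open>Finiteness of the value function\<close>

text \<open>Taking p = 0 in Fenchel's inequality bounds \<open>L\<close> below by -C, and
  \<open>g\<close> is bounded on the compact torus.\<close>

lemma total_cost_bounded_below:
  obtains m where "\<And>t \<zeta>. t \<in> {0..T} \<Longrightarrow> ereal m \<le> ereal (g (\<zeta> T)) + action L t T \<zeta>"
proof -
  obtain C where C: "\<And>x t. t \<in> {0..T} \<Longrightarrow> \<bar>H x t 0\<bar> \<le> C" using H_zero_bounded by blast
  have "compact (range g)" by (rule compact_continuous_image[OF continuous_g compact_torus])
  then obtain G where G: "\<And>x. \<bar>g x\<bar> \<le> G"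
    using compact_imp_bounded bounded_iff by (metis rangeI real_norm_def)
  have "C \<ge> 0" using C[of 0] T_pos by (meson abs_ge_zero atLeastAtMost_iff less_imp_le order_refl order_trans)
  show thesis
  proof (rule that[of "- G - C * T"])
    fix t and \<zeta> :: "real \<Rightarrow> 'n torus" assume t: "t \<in> {0..T}"
    show "ereal (- G - C * T) \<le> ereal (g (\<zeta> T)) + action L t T \<zeta>"
    proof (cases "action L t T \<zeta> = \<infinity>")
      case False
      then obtain A where A: "action L t T \<zeta> = ereal A" using action_finite_or_infinite by metis
      then have int: "(\<lambda>s. L (\<zeta> s) s (velocity \<zeta> s)) integrable_on {t..T}"
        and A_eq: "A = integral {t..T} (\<lambda>s. L (\<zeta> s) s (velocity \<zeta> s))"
        by (auto simp: action_eq_ereal_iff set_lebesgue_integral_eq_integral(1))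
      have "integral {t..T} (\<lambda>s. - C) \<le> A"
        unfolding A_eq
      proof (rule integral_le[OF _ int])
        show "(\<lambda>s. - C) integrable_on {t..T}" by (rule integrable_const_ivl)
        show "- C \<le> L (\<zeta> s) s (velocity \<zeta> s)" if "s \<in> {t..T}" for s
        proof -
          have "s \<in> {0..T}" using that t by auto
          then show ?thesis
            using Fenchel_inequality[of s 0 "velocity \<zeta> s" "\<zeta> s"] C[of s "\<zeta> s"] by (simp add: abs_le_iff)
        qed
      qed
      moreover have "integral {t..T} (\<lambda>s. - C) = - (C * (T - t))" using t by simp
      moreover have "C * (T - t) \<le> C * T" using \<open>C \<ge> 0\<close> t by (intro mult_left_mono) auto
      moreover have "- G \<le> g (\<zeta> T)" using G[of "\<zeta> T"] by linarith
      ultimately have "- G - C * T \<le> g (\<zeta> T) + A" by linarith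
      then show ?thesis using A by simp
    qed simp
  qed
qed

text \<open>\<open>real_of_ereal\<close> sends infinities to 0, so the infimum must be shown finite
  before its order properties become usable. The curve at rest, written as a line with velocity 0,
  bounds it from above.\<close>

lemma ereal_value:
  assumes "0 \<le> t" "t < T"
  shows "ereal (v x t) = (INF \<zeta>\<in>{\<zeta>. absolutely_continuous_curve t T \<zeta> \<and> \<zeta> t = x}. ereal (g (\<zeta> T)) + action L t T \<zeta>)"
    (is "_ = ?I")
proof -
  obtain m where m: "\<And>t \<zeta>. t \<in> {0..T} \<Longrightarrow> ereal m \<le> ereal (g (\<zeta> T)) + action L t T \<zeta>"
    using total_cost_bounded_below by blast
  have "ereal m \<le> ?I" by (rule INF_greatest) (use m assms in auto)
  moreover have "?I \<le> ereal (g (x \<oplus> (T - t) *\<^sub>R 0)) + ereal (segment_cost x t T 0)"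
    by (rule INF_lower2[of "\<lambda>s. x \<oplus> (s - t) *\<^sub>R 0"])
      (use action_segment[of t T x 0] absolutely_continuous_curve_line[of t T x t 0] assms in auto)
  ultimately have "\<bar>?I\<bar> \<noteq> \<infinity>" by (cases ?I) auto
  moreover have "v x t = real_of_ereal ?I" using assms(2) by (simp add: lax_oleinik_def)
  ultimately show ?thesis by (simp add: ereal_real')
qed

lemma value_le:
  assumes "0 \<le> t" "t < T" "action L t T \<zeta> = ereal A"
  shows "v (\<zeta> t) t \<le> g (\<zeta> T) + A"
proof -
  have "ereal (v (\<zeta> t) t) \<le> ereal (g (\<zeta> T)) + action L t T \<zeta>"
    unfolding ereal_value[OF assms(1,2)]
    by (rule INF_lower) (use assms(3) in \<open>simp add: action_eq_ereal_iff\<close>)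
  then show ?thesis using assms(3) by simp
qed

lemma value_approx:
  assumes "0 \<le> t" "t < T" "e > 0"
  obtains \<zeta> A where "\<zeta> t = x" "action L t T \<zeta> = ereal A" "g (\<zeta> T) + A < v x t + e"
proof -
  have "ereal (v x t) < ereal (v x t + e)" using assms(3) by simp
  then obtain \<zeta> where \<zeta>: "\<zeta> t = x" "ereal (g (\<zeta> T)) + action L t T \<zeta> < ereal (v x t + e)"
    unfolding ereal_value[OF assms(1,2)] INF_less_iff by blast
  then obtain A where "action L t T \<zeta> = ereal A"
    using action_finite_or_infinite[of L t T \<zeta>] by auto
  then show thesis using that \<zeta> by simp
qed

section \<open>Dynamic programming along segments and optimal curves\<close>

text \<open>Following the segment and then a nearly optimal curve from its end is an admissible
  competitor from (y, s).\<close>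

lemma dynamic_programming_segment:
  assumes "0 \<le> s" "s < s'" "s' < T"
  shows "v y s \<le> segment_cost y s s' q + v (y \<oplus> (s' - s) *\<^sub>R q) s'"
proof (rule field_le_epsilon)
  fix e :: real assume "e > 0"
  let ?\<sigma> = "\<lambda>r. y \<oplus> (r - s) *\<^sub>R q"
  obtain \<eta> B where \<eta>: "\<eta> s' = ?\<sigma> s'" "action L s' T \<eta> = ereal B" "g (\<eta> T) + B < v (?\<sigma> s') s' + e"
    by (rule value_approx[of s' e "?\<sigma> s'"]) (use assms \<open>e > 0\<close> in \<open>auto intro: that\<close>)
  let ?\<xi> = "\<lambda>r. if r \<le> s' then ?\<sigma> r else \<eta> r"
  have "action L s T ?\<xi> = ereal (segment_cost y s s' q + B)"
    by (rule action_join[OF action_segment \<eta>(2)]) (use assms \<eta>(1) in auto)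
  then have "v (?\<xi> s) s \<le> g (?\<xi> T) + (segment_cost y s s' q + B)"
    by (rule value_le[rotated 2]) (use assms in auto)
  then show "v y s \<le> segment_cost y s s' q + v (y \<oplus> (s' - s) *\<^sub>R q) s' + e"
    using assms \<eta>(3) by simp
qed

text \<open>Along such a segment, position, time and velocity stay within the modulus of continuity
  of \<open>L\<close>. Letting the velocity vary as well admits segments that leave the tangent
  line.\<close>

lemma value_segment_bound:
  assumes t: "0 < t" "t < T" and "e > 0"
  obtains \<delta> where "\<delta> > 0"
    "\<And>y s s' q'. dist y x < \<delta> \<Longrightarrow> dist s t < \<delta> \<Longrightarrow> dist s' t < \<delta> \<Longrightarrow> dist q' q < \<delta> \<Longrightarrow> s < s' \<Longrightarrow>
      v y s \<le> (s' - s) * (L x t q + e) + v (y \<oplus> (s' - s) *\<^sub>R q') s'"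
proof -
  obtain d where d: "d > 0"
    "\<And>x x' t t' w w'. t \<in> {0..T} \<Longrightarrow> t' \<in> {0..T} \<Longrightarrow> norm w \<le> norm q + 1 \<Longrightarrow> norm w' \<le> norm q + 1 \<Longrightarrow>
      dist x x' < d \<Longrightarrow> dist t t' < d \<Longrightarrow> dist w w' < d \<Longrightarrow> L x' t' w' \<le> L x t w + e"
    using Lagrangian_uniformly_continuous[OF \<open>e > 0\<close>, of "norm q + 1"] by metis
  have nq: "2 * norm q + 3 > 0" by (simp add: add_nonneg_pos)
  \<comment> \<open>The 1 keeps \<open>norm q'\<close> below \<open>norm q + 1\<close>; the quotient
    makes the initial offset \<delta> plus a motion during at most 2 \<delta> at that speed fit into
    \<open>d\<close>; the last two entries keep the times inside [0, T).\<close>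
  define \<delta> where "\<delta> = Min {1, d / (2 * norm q + 3), t, T - t}"
  have \<delta>_le: "\<delta> \<le> 1" "\<delta> \<le> d / (2 * norm q + 3)" "\<delta> \<le> t" "\<delta> \<le> T - t"
    unfolding \<delta>_def by (rule Min_le, simp, simp)+
  have "\<delta> > 0" unfolding \<delta>_def using t d(1) nq by simp
  have \<delta>d: "\<delta> + 2 * \<delta> * (norm q + 1) \<le> d"
    using \<delta>_le(2) nq by (simp add: pos_le_divide_eq algebra_simps)
  moreover have "2 * \<delta> * (norm q + 1) \<ge> 0" using \<open>\<delta> > 0\<close> by simp
  ultimately have "\<delta> \<le> d" by linarith
  show thesis
  proof (rule that[OF \<open>\<delta> > 0\<close>])
    fix y s s' q' assume y: "dist y x < \<delta>" and s: "dist s t < \<delta>" "dist s' t < \<delta>" "s < s'" and q': "dist q' q < \<delta>"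
    have sT: "0 \<le> s" "s' < T" using s \<delta>_le(3,4) by (auto simp: dist_real_def abs_if split: if_splits)
    have nq': "norm q' \<le> norm q + 1"
      using norm_triangle_ineq2[of q' q] q' \<delta>_le(1) by (simp add: dist_norm)
    have bound: "L (y \<oplus> (r - s) *\<^sub>R q') r q' \<le> L x t q + e" if r: "r \<in> {s..s'}" for r
    proof (rule d(2))
      have rs: "0 \<le> r - s" "r - s \<le> 2 * \<delta>" using r s by (auto simp: dist_real_def abs_if split: if_splits)
      have "dist x (y \<oplus> (r - s) *\<^sub>R q') \<le> dist y x + norm ((r - s) *\<^sub>R q')"
        using dist_translate_le[of x 0 y "(r - s) *\<^sub>R q'"] by (simp add: dist_commute)
      also have "norm ((r - s) *\<^sub>R q') = (r - s) * norm q'" using rs(1) by simp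
      also have "\<dots> \<le> 2 * \<delta> * (norm q + 1)" using rs nq' \<open>\<delta> > 0\<close> by (intro mult_mono) auto
      finally show "dist x (y \<oplus> (r - s) *\<^sub>R q') < d" using y \<delta>d by linarith
      have "dist t r < \<delta>" using r s by (auto simp: dist_real_def abs_if split: if_splits)
      then show "dist t r < d" using \<open>\<delta> \<le> d\<close> by linarith
      show "dist q q' < d" using q' \<open>\<delta> \<le> d\<close> by (simp add: dist_commute)
      show "r \<in> {0..T}" using r sT by auto
    qed (use t nq' in auto)
    have "segment_cost y s s' q' \<le> integral {s..s'} (\<lambda>r. L x t q + e)"
    proof (rule integral_le)
      show "(\<lambda>r. L (y \<oplus> (r - s) *\<^sub>R q') r q') integrable_on {s..s'}"
        by (rule integrable_continuous_real[OF continuous_Lagrangian_line]) (use sT in auto)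
      show "(\<lambda>r. L x t q + e) integrable_on {s..s'}" by (rule integrable_const_ivl)
    qed (rule bound)
    also have "\<dots> = (s' - s) * (L x t q + e)" using s(3) by simp
    finally show "v y s \<le> (s' - s) * (L x t q + e) + v (y \<oplus> (s' - s) *\<^sub>R q') s'"
      using dynamic_programming_segment[OF sT(1) s(3) sT(2), of y q'] by linarith
  qed
qed

text \<open>Optimality presupposes continuity only. Comparison with the curve at rest makes the
  action finite, and finite action includes absolute continuity.\<close>

lemma optimal_curve_finite_action:
  assumes "optimal_curve H T g \<zeta>"
  obtains A where "action L 0 T \<zeta> = ereal A"
proof -
  let ?c = "\<lambda>s. \<zeta> 0 \<oplus> (s - 0) *\<^sub>R 0"
  have "continuous_on {0..T} ?c" "?c 0 = \<zeta> 0" by simp_all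
  then have "ereal (g (\<zeta> T)) + action L 0 T \<zeta> \<le> ereal (g (?c T)) + action L 0 T ?c"
    using assms unfolding optimal_curve_def by blast
  also have "action L 0 T ?c = ereal (segment_cost (\<zeta> 0) 0 T 0)"
    using action_segment[of 0 T "\<zeta> 0" 0] T_pos by simp
  finally show thesis
    using that action_finite_or_infinite[of L 0 T \<zeta>] by auto
qed

text \<open>The tail of an optimal curve is optimal: a better tail from the same point could be
  attached to the initial piece and would improve the whole curve.\<close>

lemma value_along_optimal_curve:
  assumes opt: "optimal_curve H T g \<zeta>" and t: "0 \<le> t" "t < T"
    and A: "action L t T \<zeta> = ereal A"
  shows "v (\<zeta> t) t = g (\<zeta> T) + A"
proof (rule antisym)
  show "v (\<zeta> t) t \<le> g (\<zeta> T) + A" by (rule value_le[OF t A])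
  obtain A0 where A0: "action L 0 T \<zeta> = ereal A0" using optimal_curve_finite_action[OF opt] .
  obtain A1 A2 where A1: "action L 0 t \<zeta> = ereal A1" "action L t T \<zeta> = ereal A2" "A0 = A1 + A2"
    by (rule action_split[OF A0, of t]) (use t in auto)
  show "g (\<zeta> T) + A \<le> v (\<zeta> t) t"
  proof (rule field_le_epsilon)
    fix e :: real assume "e > 0"
    obtain \<eta> B where \<eta>: "\<eta> t = \<zeta> t" "action L t T \<eta> = ereal B" "g (\<eta> T) + B < v (\<zeta> t) t + e"
      using value_approx[OF t \<open>e > 0\<close>, of "\<zeta> t"] by metis
    let ?\<xi> = "\<lambda>r. if r \<le> t then \<zeta> r else \<eta> r"
    have \<xi>: "action L 0 T ?\<xi> = ereal (A1 + B)"
      by (rule action_join[OF A1(1) \<eta>(2)]) (use t \<eta>(1) in auto)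
    then have "continuous_on {0..T} ?\<xi>"
      by (intro absolutely_continuous_curve_imp_continuous_on) (simp add: action_eq_ereal_iff)
    moreover have "?\<xi> 0 = \<zeta> 0" using t by simp
    ultimately have "ereal (g (\<zeta> T)) + action L 0 T \<zeta> \<le> ereal (g (?\<xi> T)) + action L 0 T ?\<xi>"
      using opt unfolding optimal_curve_def by blast
    then have "g (\<zeta> T) + A0 \<le> g (\<eta> T) + (A1 + B)" using \<xi> A0 t by simp
    then show "g (\<zeta> T) + A \<le> v (\<zeta> t) t + e" using A1 A \<eta>(3) by simp
  qed
qed

text \<open>The value along the curve decreases at rate \<open>L\<close>; it is transferred to the tangent line by
  segments of duration \<open>\<bar>h\<bar>\<close>, whose velocity tends to \<open>q\<close>: from the line at time \<open>t + h\<close> to the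
  curve at time \<open>t + 2 h\<close> for \<open>h > 0\<close>, and backwards for \<open>h < 0\<close>. No regularity of the
  value function is needed.\<close>

lemma dir_deriv_of_deriv_along_curve:
  assumes t: "0 < t" "t < T" and vel: "has_velocity \<zeta> q t"
    and deriv: "((\<lambda>h. (v (\<zeta> (t + h)) (t + h) - v (\<zeta> t) t) / h) \<longlongrightarrow> - L (\<zeta> t) t q) (at 0)"
  shows "has_dir_deriv v (\<zeta> t) t q (- L (\<zeta> t) t q)"
  unfolding has_dir_deriv_def
proof (rule tendstoI)
  let ?x = "\<zeta> t" and ?l = "L (\<zeta> t) t q"
  fix e0 :: real assume "e0 > 0"
  \<comment> \<open>The estimate loses 3 e per unit of |h|: once on a segment of duration |h| and
    twice from the derivative along the curve over 2 |h|.\<close>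
  define e where "e = e0 / 4"
  have "e > 0" using \<open>e0 > 0\<close> by (simp add: e_def)
  obtain \<delta> where \<delta>: "\<delta> > 0"
    "\<And>y s s' q'. dist y ?x < \<delta> \<Longrightarrow> dist s t < \<delta> \<Longrightarrow> dist s' t < \<delta> \<Longrightarrow> dist q' q < \<delta> \<Longrightarrow> s < s' \<Longrightarrow>
      v y s \<le> (s' - s) * (?l + e) + v (y \<oplus> (s' - s) *\<^sub>R q') s'"
    using value_segment_bound[OF t \<open>e > 0\<close>, of ?x q] by metis
  have two: "filterlim (\<lambda>h :: real. 2 * h) (at 0) (at 0)"
    unfolding filterlim_at by (auto intro!: tendsto_eq_intros simp: eventually_at_filter)
  have nq: "2 * (norm q + \<delta> + 1) > 0" using \<delta>(1) by (simp add: add_nonneg_pos add_pos_pos)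
  \<comment> \<open>This smallness yields \<open>hb\<close>, a single inequality covering both the
    distance from \<open>?x\<close> to the curve and the time lag 2 |h|.\<close>
  have ev1: "eventually (\<lambda>h. \<bar>h\<bar> < \<delta> / (2 * (norm q + \<delta> + 1))) (at (0 :: real))"
    unfolding eventually_at using \<delta>(1) nq by (intro exI[of _ "\<delta> / (2 * (norm q + \<delta> + 1))"]) auto
  have ev2: "eventually (\<lambda>h. dist (\<zeta> (t + 2 * h)) (?x \<oplus> (2 * h) *\<^sub>R q) / \<bar>2 * h\<bar> < \<delta> / 2) (at 0)"
    using order_tendstoD(2)[OF filterlim_compose[OF vel[unfolded has_velocity_def] two]] \<delta>(1) half_gt_zero by blast
  have ev3: "eventually (\<lambda>h. dist ((v (\<zeta> (t + 2 * h)) (t + 2 * h) - v ?x t) / (2 * h)) (- ?l) < e) (at 0)"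
    using tendstoD[OF filterlim_compose[OF deriv two] \<open>e > 0\<close>] .
  show "eventually (\<lambda>h. dist ((v (?x \<oplus> h *\<^sub>R q) (t + h) - v ?x t) / h) (- ?l) < e0) (at 0)"
    using ev1 ev2 ev3 eventually_neq_at_within[of 0 "0 :: real" UNIV]
  proof eventually_elim
    case (elim h)
    let ?z = "\<zeta> (t + 2 * h)" and ?D = "v (?x \<oplus> h *\<^sub>R q) (t + h) - v ?x t"
    have twice: "(2 * h) *\<^sub>R q = h *\<^sub>R q + h *\<^sub>R q" by (metis mult_2 scaleR_add_left)
    have h0: "\<bar>h\<bar> > 0" using elim(4) by simp
    have "\<bar>h\<bar> * (2 * (norm q + \<delta> + 1)) < \<delta>" using elim(1) nq by (simp add: pos_less_divide_eq)
    then have hb: "2 * (\<bar>h\<bar> * norm q) + 2 * (\<bar>h\<bar> * \<delta>) + 2 * \<bar>h\<bar> < \<delta>" by (simp add: algebra_simps)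
    have nonneg: "0 \<le> \<bar>h\<bar> * norm q" "0 \<le> \<bar>h\<bar> * \<delta>" using \<delta>(1) by simp_all
    obtain w where w: "?z = ?x \<oplus> (2 * h) *\<^sub>R q \<oplus> w" "norm w = dist (?x \<oplus> (2 * h) *\<^sub>R q) ?z"
      using torus_displacement .
    have "norm w < \<delta> / 2 * \<bar>2 * h\<bar>"
      using elim(2) h0 unfolding w(2) dist_commute[of _ ?z] by (simp only: pos_divide_less_eq)
    then have wh: "norm w < \<bar>h\<bar> * \<delta>" by (simp add: abs_mult mult.commute)
    have z: "dist ?z ?x < \<delta>"
    proof -
      have "dist ?z ?x \<le> norm ((2 * h) *\<^sub>R q + w)"
        using dist_translate_le[of ?x "(2 * h) *\<^sub>R q + w" ?x 0] w(1) by (simp add: translate_translate)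
      also have "\<dots> \<le> norm ((2 * h) *\<^sub>R q) + norm w" by (rule norm_triangle_ineq)
      also have "norm ((2 * h) *\<^sub>R q) = 2 * (\<bar>h\<bar> * norm q)" by (simp add: abs_mult)
      finally show ?thesis using wh hb nonneg by linarith
    qed
    have y: "dist (?x \<oplus> h *\<^sub>R q) ?x < \<delta>"
    proof -
      have "dist (?x \<oplus> h *\<^sub>R q) ?x \<le> \<bar>h\<bar> * norm q" using dist_translate_le[of ?x "h *\<^sub>R q" ?x 0] by simp
      then show ?thesis using hb nonneg by linarith
    qed
    have times: "dist t t < \<delta>" "dist (t + h) t < \<delta>" "dist (t + 2 * h) t < \<delta>"
    proof -
      have "2 * \<bar>h\<bar> < \<delta>" using hb nonneg by linarith
      then show "dist t t < \<delta>" "dist (t + h) t < \<delta>" "dist (t + 2 * h) t < \<delta>"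
        using \<delta>(1) by (simp_all add: dist_real_def abs_mult)
    qed
    have qq: "dist q q < \<delta>" "dist ?x ?x < \<delta>" using \<delta>(1) by simp_all
    have near: "\<bar>(v ?z (t + 2 * h) - v ?x t) / (2 * h) + ?l\<bar> < e"
      using elim(3) by (simp add: dist_real_def)
    have "\<bar>?D / h + ?l\<bar> \<le> 3 * e"
    proof (cases "h > 0")
      case True
      \<comment> \<open>Here the point of the line is the end of a segment that starts at
        \<open>?x\<close> with velocity \<open>q\<close>.\<close>
      have "v ?x t \<le> h * (?l + e) + v (?x \<oplus> h *\<^sub>R q) (t + h)"
        using \<delta>(2)[OF qq(2) times(1,2) qq(1)] True by simp
      then have "(- ?l - e) * h \<le> ?D" by (simp add: algebra_simps)
      then have lower: "- ?l - e \<le> ?D / h" by (simp only: pos_le_divide_eq[OF True])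
      \<comment> \<open>This velocity leads in time \<open>h\<close> from the line exactly to
        \<open>?z\<close>, and it differs from \<open>q\<close> by less than \<delta>.\<close>
      let ?q = "q + w /\<^sub>R h"
      have "dist ?q q = norm w / h" using True by (simp add: dist_norm divide_inverse mult.commute)
      moreover have "norm w < \<delta> * h" using wh True by (simp add: mult.commute)
      ultimately have "dist ?q q < \<delta>" by (simp only: pos_divide_less_eq[OF True])
      then have "v (?x \<oplus> h *\<^sub>R q) (t + h) \<le> h * (?l + e) + v (?x \<oplus> h *\<^sub>R q \<oplus> h *\<^sub>R ?q) (t + 2 * h)"
        using \<delta>(2)[OF y times(2,3)] True by simp
      moreover have "?x \<oplus> h *\<^sub>R q \<oplus> h *\<^sub>R ?q = ?z"
        unfolding w(1) translate_translate using True
        by (simp only: twice scaleR_add_right) (simp add: add.assoc)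
      moreover have "v ?z (t + 2 * h) - v ?x t < (e - ?l) * (2 * h)"
      proof -
        have "(v ?z (t + 2 * h) - v ?x t) / (2 * h) < e - ?l" using near by linarith
        then show ?thesis using True by (simp add: pos_divide_less_eq)
      qed
      ultimately have "?D \<le> (3 * e - ?l) * h" by (simp add: algebra_simps)
      then have "?D / h \<le> 3 * e - ?l" using True by (simp add: pos_divide_le_eq)
      then show ?thesis using lower \<open>e > 0\<close> by linarith
    next
      case False
      define k where "k = - h"
      have k: "k > 0" "h = - k" using False elim(4) by (auto simp: k_def)
      have "v (?x \<oplus> h *\<^sub>R q) (t + h) \<le> k * (?l + e) + v (?x \<oplus> h *\<^sub>R q \<oplus> k *\<^sub>R q) t"
        using \<delta>(2)[OF y times(2,1) qq(1)] k by simp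
      then have "?D \<le> k * (?l + e)" using k by (simp add: translate_translate)
      then have "?D / k \<le> ?l + e" using k(1) by (simp add: pos_divide_le_eq mult.commute)
      then have lower: "- ?l - e \<le> ?D / h" unfolding k(2) by simp
      \<comment> \<open>Backwards in time the curve point \<open>?z\<close> is the earlier one; this
        velocity leads from it to the line in time \<open>k\<close>.\<close>
      let ?q = "q - w /\<^sub>R k"
      have "dist ?q q = norm w / k" using k(1) by (simp add: dist_norm divide_inverse mult.commute)
      moreover have "norm w < \<delta> * k" using wh k by (simp add: mult.commute)
      ultimately have "dist ?q q < \<delta>" by (simp only: pos_divide_less_eq[OF k(1)])
      then have "v ?z (t + 2 * h) \<le> k * (?l + e) + v (?z \<oplus> k *\<^sub>R ?q) (t + h)"
        using \<delta>(2)[OF z times(3,2)] k by simp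
      moreover have "?z \<oplus> k *\<^sub>R ?q = ?x \<oplus> h *\<^sub>R q"
      proof -
        have z: "?z = ?x \<oplus> h *\<^sub>R q \<oplus> (h *\<^sub>R q + w)"
          by (simp only: w(1) translate_translate twice add.assoc)
        have kq: "k *\<^sub>R ?q = - (h *\<^sub>R q + w)" using k by (simp add: scaleR_diff_right)
        show ?thesis unfolding z kq translate_translate[of "?x \<oplus> h *\<^sub>R q"] by simp
      qed
      moreover have "v ?x t - v ?z (t + 2 * h) < (e - ?l) * (2 * k)"
      proof -
        have "(v ?z (t + 2 * h) - v ?x t) / (2 * h) = (v ?x t - v ?z (t + 2 * h)) / (2 * k)"
          using k by (simp add: field_simps)
        then have "(v ?x t - v ?z (t + 2 * h)) / (2 * k) < e - ?l" using near by linarith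
        then show ?thesis using k(1) by (simp add: pos_divide_less_eq)
      qed
      ultimately have "- ?D \<le> (3 * e - ?l) * k" by (simp add: algebra_simps)
      then have "- ?D / k \<le> 3 * e - ?l" using k(1) by (simp add: pos_divide_le_eq)
      moreover have "r / h = - r / k" for r using k(2) by simp
      ultimately have "?D / h \<le> 3 * e - ?l" by (simp only:)
      then show ?thesis using lower \<open>e > 0\<close> by linarith
    qed
    also have "3 * e < e0" using \<open>e0 > 0\<close> by (simp add: e_def)
    finally show "dist (?D / h) (- ?l) < e0" by (simp add: dist_real_def)
  qed
qed

text \<open>Going straight from \<open>(x - h q\<^sub>1, t - h)\<close> to \<open>(x + h q\<^sub>2, t + h)\<close> shows that \<open>L\<close> is affine
  between two optimal velocities, so both lie in the subdifferential of \<open>H\<close> at a common point.\<close>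

lemma optimal_velocities_unique:
  assumes t: "0 < t" "t < T" and diff: "\<And>p. H x t differentiable (at p)"
    and q: "q1 \<in> optimal_velocities H T g x t" "q2 \<in> optimal_velocities H T g x t"
  shows "q1 = q2"
proof -
  \<comment> \<open>The displacement h (q1 + q2) is covered in time 2 h, which makes
    \<open>m\<close> the velocity of the straight segment.\<close>
  define m where "m = (1 / 2) *\<^sub>R (q1 + q2)"
  have "L x t q1 + L x t q2 \<le> 2 * L x t m"
  proof (rule field_le_epsilon)
    fix e0 :: real assume "e0 > 0"
    define e where "e = e0 / 2"
    have "e > 0" using \<open>e0 > 0\<close> by (simp add: e_def)
    obtain \<delta> where \<delta>: "\<delta> > 0"
      "\<And>y s s' q'. dist y x < \<delta> \<Longrightarrow> dist s t < \<delta> \<Longrightarrow> dist s' t < \<delta> \<Longrightarrow> dist q' m < \<delta> \<Longrightarrow> s < s' \<Longrightarrow>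
        v y s \<le> (s' - s) * (L x t m + e) + v (y \<oplus> (s' - s) *\<^sub>R q') s'"
      using value_segment_bound[OF t \<open>e > 0\<close>, of x m] by metis
    let ?a = "\<lambda>h. (v (x \<oplus> (- h) *\<^sub>R q1) (t + - h) - v x t) / (- h)"
    let ?b = "\<lambda>h. (v (x \<oplus> h *\<^sub>R q2) (t + h) - v x t) / h"
    \<comment> \<open>The quotient for \<open>q1\<close> is needed at negative increments, since the
      segment starts before time \<open>t\<close>.\<close>
    have neg: "filterlim (\<lambda>h :: real. - h) (at 0) (at_right 0)"
      unfolding filterlim_at by (auto intro!: tendsto_eq_intros simp: eventually_at_filter)
    have lim: "(?a \<longlongrightarrow> - L x t q1) (at_right 0)" "(?b \<longlongrightarrow> - L x t q2) (at_right 0)"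
      using q filterlim_compose[OF _ neg, of "\<lambda>h. (v (x \<oplus> h *\<^sub>R q1) (t + h) - v x t) / h"]
      unfolding optimal_velocities_def has_dir_deriv_def
      by (auto intro: filterlim_mono at_le)
    have nq: "norm q1 + 1 > 0" by (simp add: add_nonneg_pos)
    have "eventually (\<lambda>h :: real. 0 < h \<and> h < \<delta> / (norm q1 + 1)) (at_right 0)"
      using eventually_at_right_less eventually_at_right_real[of 0 "\<delta> / (norm q1 + 1)"] \<delta>(1) nq
      by (auto elim: eventually_mono)
    then have "eventually (\<lambda>h. - (?a h + ?b h) \<le> 2 * (L x t m + e)) (at_right 0)"
    proof eventually_elim
      case (elim h)
      have "h * (norm q1 + 1) < \<delta>" using elim nq by (simp add: pos_less_divide_eq)
      then have hb: "h * norm q1 + h < \<delta>" by (simp add: distrib_left)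
      have hn: "0 \<le> h * norm q1" using elim by simp
      have "dist (x \<oplus> (- h) *\<^sub>R q1) x \<le> h * norm q1"
        using dist_translate_le[of x "(- h) *\<^sub>R q1" x 0] elim by simp
      then have "dist (x \<oplus> (- h) *\<^sub>R q1) x < \<delta>" using hb elim by linarith
      moreover have "dist (t + - h) t < \<delta>" "dist (t + h) t < \<delta>"
        using hb hn elim by (simp_all add: dist_real_def, linarith+)
      ultimately have "v (x \<oplus> (- h) *\<^sub>R q1) (t + - h) \<le> (t + h - (t + - h)) * (L x t m + e) +
          v (x \<oplus> (- h) *\<^sub>R q1 \<oplus> (t + h - (t + - h)) *\<^sub>R m) (t + h)"
        by (rule \<delta>(2)) (use \<delta>(1) elim in simp_all)
      moreover have "(- h) *\<^sub>R q1 + (t + h - (t + - h)) *\<^sub>R m = h *\<^sub>R q2"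
        by (simp add: m_def scaleR_add_right)
      ultimately have le: "v (x \<oplus> (- h) *\<^sub>R q1) (t + - h) \<le> 2 * h * (L x t m + e) + v (x \<oplus> h *\<^sub>R q2) (t + h)"
        by (simp add: translate_translate)
      have "- (?a h + ?b h) = (v (x \<oplus> (- h) *\<^sub>R q1) (t + - h) - v (x \<oplus> h *\<^sub>R q2) (t + h)) / h"
        using elim by (simp add: field_simps)
      also have "\<dots> \<le> 2 * (L x t m + e)"
        using le elim by (simp add: pos_divide_le_eq algebra_simps)
      finally show ?case .
    qed
    moreover have "((\<lambda>h. - (?a h + ?b h)) \<longlongrightarrow> - (- L x t q1 + - L x t q2)) (at_right 0)"
      by (intro tendsto_minus tendsto_add lim)
    ultimately have "- (- L x t q1 + - L x t q2) \<le> 2 * (L x t m + e)"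
      by (intro tendsto_upperbound) auto
    then show "L x t q1 + L x t q2 \<le> 2 * L x t m + e0" by (simp add: e_def)
  qed
  moreover have t': "t \<in> {0..T}" using t by simp
  then obtain p where p: "L x t m = p \<bullet> m - H x t p"
    using maximizer[of "norm m"] by (metis order_refl)
  have F: "p' \<bullet> w - H x t p' \<le> L x t w" for p' w by (rule Fenchel_inequality[OF t'])
  \<comment> \<open>Fenchel's inequalities at \<open>p\<close> for \<open>q1\<close> and
    \<open>q2\<close> add up to the lower bound 2 L(x, t, m), which the inequality just proved shows
    to be an upper bound too; so both are equalities.\<close>
  have "2 * (p \<bullet> m) = p \<bullet> q1 + p \<bullet> q2" by (simp add: m_def inner_add_right)
  ultimately have eq: "L x t q1 = p \<bullet> q1 - H x t p" "L x t q2 = p \<bullet> q2 - H x t p"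
    using p F[of p q1] F[of p q2] by linarith+
  show ?thesis
    by (rule differentiable_maximizer_unique_slope[OF diff F[of _ q1, unfolded eq(1)] F[of _ q2, unfolded eq(2)]])
qed

text \<open>A single \<open>q\<close> that is both the velocity of the curve and an optimal velocity
  yields both claims of the theorem. The null set collects the times without velocity and those
  where the running action fails to have the integrand as derivative.\<close>

lemma optimal_curve_ae:
  assumes opt: "optimal_curve H T g \<zeta>"
  obtains N where "negligible N" "\<And>t. t \<in> {0<..<T} - N \<Longrightarrow>
    \<exists>q. has_velocity \<zeta> q t \<and> q \<in> optimal_velocities H T g (\<zeta> t) t"
proof -
  obtain A where A: "action L 0 T \<zeta> = ereal A" using optimal_curve_finite_action[OF opt] .
  define f where "f = (\<lambda>s. L (\<zeta> s) s (velocity \<zeta> s))"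
  have ac: "absolutely_continuous_curve 0 T \<zeta>" using A by (simp add: action_eq_ereal_iff)
  have int: "f integrable_on {0..T}"
    using A unfolding f_def by (auto simp: action_eq_ereal_iff set_lebesgue_integral_eq_integral(1))
  have val: "v (\<zeta> s) s = g (\<zeta> T) + A - integral {0..s} f" if s: "0 < s" "s < T" for s
  proof -
    obtain A1 A2 where A1: "action L 0 s \<zeta> = ereal A1" "action L s T \<zeta> = ereal A2" "A = A1 + A2"
      by (rule action_split[OF A, of s]) (use s in auto)
    moreover have "A1 = integral {0..s} f" using A1(1) by (simp add: action_eq_ereal_iff f_def)
    ultimately show ?thesis using value_along_optimal_curve[OF opt _ _ A1(2)] s by simp
  qed
  let ?N1 = "{t \<in> {0<..<T}. \<not> (\<exists>q. has_velocity \<zeta> q t)}"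
  let ?N2 = "{t \<in> {0<..<T}. \<not> ((\<lambda>h. (integral {0..t + h} f - integral {0..t} f) / h) \<longlongrightarrow> f t) (at 0)}"
  show thesis
  proof (rule that)
    show "negligible (?N1 \<union> ?N2)"
      by (intro negligible_Un absolutely_continuous_curve_has_velocity_ae[OF ac] integral_has_derivative_ae[OF int])
    fix t assume tN: "t \<in> {0<..<T} - (?N1 \<union> ?N2)"
    then have t: "0 < t" "t < T" by auto
    obtain q where q: "has_velocity \<zeta> q t" using tN by blast
    have f: "f t = L (\<zeta> t) t q" by (simp add: f_def velocity_eqI[OF q])
    have "((\<lambda>h. (integral {0..t + h} f - integral {0..t} f) / h) \<longlongrightarrow> f t) (at 0)" using tN by blast
    then have lim: "((\<lambda>h. - ((integral {0..t + h} f - integral {0..t} f) / h)) \<longlongrightarrow> - f t) (at 0)"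
      by (rule tendsto_minus)
    have "eventually (\<lambda>h. \<bar>h\<bar> < min t (T - t)) (at (0 :: real))"
      unfolding eventually_at using t by (intro exI[of _ "min t (T - t)"]) auto
    then have "eventually (\<lambda>h. - ((integral {0..t + h} f - integral {0..t} f) / h) =
      (v (\<zeta> (t + h)) (t + h) - v (\<zeta> t) t) / h) (at 0)"
    proof eventually_elim
      case (elim h)
      have "0 < t + h" "t + h < T" using elim by auto
      then have "v (\<zeta> (t + h)) (t + h) - v (\<zeta> t) t = - (integral {0..t + h} f - integral {0..t} f)"
        using val[of t] val[of "t + h"] t by simp
      then show ?case by (simp only: minus_divide_left)
    qed
    then have "((\<lambda>h. (v (\<zeta> (t + h)) (t + h) - v (\<zeta> t) t) / h) \<longlongrightarrow> - L (\<zeta> t) t q) (at 0)"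
      using lim unfolding f by (rule Lim_transform_eventually[rotated])
    then have "has_dir_deriv v (\<zeta> t) t q (- L (\<zeta> t) t q)"
      by (rule dir_deriv_of_deriv_along_curve[OF t q])
    then show "\<exists>q. has_velocity \<zeta> q t \<and> q \<in> optimal_velocities H T g (\<zeta> t) t"
      using q by (auto simp: optimal_velocities_def)
  qed
qed

end

theorem proposition6p6:
  fixes H :: "'n::finite torus \<Rightarrow> real \<Rightarrow> real ^ 'n \<Rightarrow> real"
    and g :: "'n torus \<Rightarrow> real"
    and T :: real
    and \<zeta> :: "real \<Rightarrow> 'n torus"
  assumes "T > 0"
    and "continuous_on (UNIV \<times> {0..T} \<times> UNIV) (\<lambda>(x, t, p). H x t p)"
    and "\<And>x t. t \<in> {0..T} \<Longrightarrow> convex_on UNIV (H x t)"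
    and "\<And>M :: real. eventually (\<lambda>p. \<forall>x. \<forall>t\<in>{0..T}. M \<le> H x t p / norm p) at_infinity"
    and "\<And>x t p. t \<in> {0..T} \<Longrightarrow> H x t differentiable (at p)"
    and "continuous_on UNIV g"
    and "optimal_curve H T g \<zeta>"
  shows "(\<forall>W. borel_extension H T g W \<longrightarrow> integral_curve T W \<zeta>) \<and>
    (AE t\<in>{0..T} in lebesgue. (\<zeta> t, t) \<in> optimal_set H T g)"
proof -
  interpret lax_oleinik_problem H T g
    using assms(1,2,4,6) by unfold_locales
  obtain N where N: "negligible N" "\<And>t. t \<in> {0<..<T} - N \<Longrightarrow>
    \<exists>q. has_velocity \<zeta> q t \<and> q \<in> optimal_velocities H T g (\<zeta> t) t"
    using optimal_curve_ae[OF assms(7)] by blast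
  \<comment> \<open>\<open>optimal_set\<close> contains interior times only, so both end points go
    into the null set.\<close>
  have "negligible (N \<union> {0, T})" by (intro negligible_Un N(1)) simp
  then have null: "AE t in lebesgue. t \<notin> N \<union> {0, T}"
    unfolding negligible_iff_null_sets by (rule AE_not_in)
  have in_set: "(\<zeta> t, t) \<in> optimal_set H T g" if "t \<in> {0<..<T} - N" for t
    using N(2)[OF that] that by (auto simp: optimal_set_def)
  have vel: "has_velocity \<zeta> (W (\<zeta> t, t)) t" if W: "borel_extension H T g W" and t: "t \<in> {0<..<T} - N" for W t
  proof -
    obtain q where q: "has_velocity \<zeta> q t" "q \<in> optimal_velocities H T g (\<zeta> t) t" using N(2)[OF t] by blast
    \<comment> \<open>Uniqueness makes \<open>the_elem\<close> equal to the velocity found, for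
      every Borel extension \<open>W\<close>.\<close>
    have "q' = q" if "q' \<in> optimal_velocities H T g (\<zeta> t) t" for q'
      by (rule optimal_velocities_unique[OF _ _ _ that q(2)]) (use t assms(5) in auto)
    then have "optimal_velocities H T g (\<zeta> t) t = {q}" using q(2) by blast
    moreover have "W (\<zeta> t, t) = the_elem (optimal_velocities H T g (\<zeta> t) t)"
      using W in_set[OF t] unfolding borel_extension_def by blast
    ultimately show ?thesis using q(1) by simp
  qed
  have "absolutely_continuous_curve 0 T \<zeta>"
    using optimal_curve_finite_action[OF assms(7)] by (metis action_eq_ereal_iff)
  moreover have "AE t\<in>{0..T} in lebesgue. has_velocity \<zeta> (W (\<zeta> t, t)) t" if "borel_extension H T g W" for W
    using null by eventually_elim (auto intro: vel[OF that])
  moreover have "AE t\<in>{0..T} in lebesgue. (\<zeta> t, t) \<in> optimal_set H T g"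
    using null by eventually_elim (auto intro: in_set)
  ultimately show ?thesis by (simp add: integral_curve_def)
qed

end
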